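(* Suppose that $H$ is a graph for which there exist a function $f:(0,1]\to(0,1]$ and a constant $a>0$ such that, for every $d\in(0,1]$, every $(f(d),d)$-dense graph $G$ contains at least $a|V(G)|^{|V(H)|}d^{|E(H)|}$ copies of $H$. Then the subdivision of $H$ has Sidorenko's property.
   Context: Graphs are finite and simple. A graph $G$ is $(\rho,d)$-dense if for every $U\subseteq V(G)$ with $|U|\ge\rho|V(G)|$, the number of edges of $G$ inside $U$ is at least $d\binom{|U|}{2}$. Copies of $H$ are counted as labeled copies (the paper's surrounding discussion speaks of labeled copies). $\mathrm{Hom}(H,G)$ is the set of homomorphisms $H\to G$; $H$ has Sidorenko's property if for every graph $G$, $|\mathrm{Hom}(H,G)|\ge |V(G)|^{|V(H)|}\left(\frac{2|E(G)|}{|V(G)|^2}\right)^{|E(H)|}$. The subdivision of $H$ is obtained by replacing each edge of $H$ by a path of length two, with a distinct new middle vertex for each edge. *)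

theory Defs
  imports Complex_Main "HOL-Library.FuncSet"
begin

record 'a ugraph =
  verts :: "'a set"
  edges :: "'a set set"

definition simple_graph :: "'a ugraph \<Rightarrow> bool" where
  "simple_graph G \<longleftrightarrow> finite (verts G) \<and> (\<forall>e\<in>edges G. e \<subseteq> verts G \<and> card e = 2)"

definition locally_dense :: "real \<Rightarrow> real \<Rightarrow> 'a ugraph \<Rightarrow> bool" where
  "locally_dense \<rho> d G \<longleftrightarrow>
     (\<forall>U \<subseteq> verts G. real (card U) \<ge> \<rho> * real (card (verts G)) \<longrightarrow>
        real (card {e \<in> edges G. e \<subseteq> U}) \<ge> d * real (card U choose 2))"

text \<open>An edge of a simple graph has two elements, so \<open>\<phi> ` e \<in> edges G\<close> forces the two ends of
  \<open>e\<close> to have distinct, adjacent images. Maps are extensional, so that each homomorphism is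
  counted once.\<close>

definition homs :: "'a ugraph \<Rightarrow> 'b ugraph \<Rightarrow> ('a \<Rightarrow> 'b) set" where
  "homs H G = {\<phi> \<in> verts H \<rightarrow>\<^sub>E verts G. \<forall>e\<in>edges H. \<phi> ` e \<in> edges G}"

definition labeled_copies :: "'a ugraph \<Rightarrow> 'b ugraph \<Rightarrow> ('a \<Rightarrow> 'b) set" where
  "labeled_copies H G = {\<phi> \<in> homs H G. inj_on \<phi> (verts H)}"

text \<open>Every finite graph is isomorphic to one whose vertices are natural numbers, so nothing is
  lost by letting \<open>G\<close> range over those. The graph without vertices is included; there the
  convention \<open>0 / 0 = 0\<close> makes the inequality true.\<close>

definition sidorenko :: "'a ugraph \<Rightarrow> bool" where
  "sidorenko H \<longleftrightarrow>
     (\<forall>G :: nat ugraph. simple_graph G \<longrightarrow>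
        real (card (homs H G)) \<ge>
          real (card (verts G)) ^ card (verts H) *
          (2 * real (card (edges G)) / real (card (verts G)) ^ 2) ^ card (edges H))"

text \<open>The middle vertex of the path replacing the edge \<open>e\<close> is \<open>Inr e\<close>.\<close>

definition subdivision :: "'a ugraph \<Rightarrow> ('a + 'a set) ugraph" where
  "subdivision H =
     \<lparr>verts = Inl ` verts H \<union> Inr ` edges H,
      edges = {{Inl v, Inr e} | v e. e \<in> edges H \<and> v \<in> e}\<rparr>"

lemma simple_graph_subdivision:
  assumes "simple_graph H"
  shows "simple_graph (subdivision H)"
proof -
  have "edges H \<subseteq> Pow (verts H)" "finite (verts H)"
    using assms by (auto simp: simple_graph_def)
  then have "finite (edges H)"
    by (meson finite_Pow_iff finite_subset)
  then show ?thesis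
    using assms by (auto simp: simple_graph_def subdivision_def)
qed

text \<open>A lower bound of order \<open>|V(G)| ^ |V(H)|\<close> on the number of labeled copies of \<open>H\<close> in
  locally dense graphs \<open>G\<close> is meant for all sufficiently large \<open>G\<close>: if \<open>H\<close> has an edge, it
  fails for the one-vertex graph, which is \<open>(\<rho>, d)\<close>-dense for all \<open>\<rho>\<close> and \<open>d\<close>. Therefore
  \<open>dense_count_bound\<close> has a threshold \<open>n\<^sub>0\<close>, which may depend on \<open>d\<close>; the bound for all \<open>G\<close>
  is the case \<open>n\<^sub>0 = 0\<close>. Again \<open>G\<close> ranges over the graphs on natural numbers.\<close>

lemma locally_dense_one_vertex: "locally_dense \<rho> d \<lparr>verts = {x}, edges = {}\<rparr>"
  by (auto simp: locally_dense_def subset_singleton_iff binomial_eq_0)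

lemma homs_one_vertex:
  "edges H \<noteq> {} \<Longrightarrow> homs H \<lparr>verts = {x}, edges = {}\<rparr> = {}"
  by (auto simp: homs_def)

definition dense_count_bound :: "'a ugraph \<Rightarrow> (real \<Rightarrow> real) \<Rightarrow> real \<Rightarrow> real \<Rightarrow> bool" where
  "dense_count_bound H f a d \<longleftrightarrow>
     (\<exists>n\<^sub>0 :: nat. \<forall>G :: nat ugraph.
        simple_graph G \<and> card (verts G) \<ge> n\<^sub>0 \<and> locally_dense (f d) d G \<longrightarrow>
        real (card (labeled_copies H G)) \<ge>
          a * real (card (verts G)) ^ card (verts H) * d ^ card (edges H))"

end

theory Submission
  imports Defs "HOL-Analysis.Convex"
begin

text \<open>Homomorphisms from the subdivision of \<open>H\<close> to \<open>G\<close> are counted by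
  \<open>S = \<Sum>\<^sub>\<phi> \<Prod>\<^sub>e codeg (\<phi> e)\<close>, where \<open>\<phi>\<close> ranges over all maps from the vertices of \<open>H\<close> to those of \<open>G\<close>.
  Let \<open>G\<close> have density \<open>q\<close>. Sample many vertices of \<open>G\<close>, each with multiplicity proportional to its
  degree and only those of degree at least \<open>l\<close>, half of the average degree, and join the samples
  \<open>x, y\<close> independently with probability \<open>l * codeg (x, y) / (deg x * deg y)\<close>. By Cauchy-Schwarz
  these probabilities have average at least about \<open>q / 2\<close> on every set of samples, so the random graph is
  \<open>(f (q / 16), q / 16)\<close>-dense with probability at least \<open>1 / 2\<close>. Its expected number of copies of
  \<open>H\<close> is at most a normalised \<open>S\<close>, and the hypothesis then yields the Sidorenko bound for \<open>S\<close> up to a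
  constant factor independent of \<open>q\<close>. Tensor powers remove the constant. For that reason \<open>S\<close> is
  defined for an arbitrary bipartite incidence relation between sets \<open>V\<close> and \<open>Z\<close>. Isolated vertices
  of \<open>H\<close> contribute the same factor to both sides and are removed first.\<close>

subsection \<open>Random graphs with independent edges\<close>

text \<open>The probability that the outcome is exactly \<open>E\<close> when each \<open>p\<close>
  in \<open>P\<close> is kept independently with probability \<open>w p\<close>. Expectations become
  finite sums over \<open>Pow P\<close>.\<close>

definition bernoulli_weight :: "'e set \<Rightarrow> ('e \<Rightarrow> real) \<Rightarrow> 'e set \<Rightarrow> real" where
  "bernoulli_weight P w E = (\<Prod>p\<in>E. w p) * (\<Prod>p\<in>P - E. 1 - w p)"

lemma bernoulli_weight_nonneg:
  assumes "E \<subseteq> P" "\<And>p. p \<in> P \<Longrightarrow> 0 \<le> w p \<and> w p \<le> 1"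
  shows "0 \<le> bernoulli_weight P w E"
  unfolding bernoulli_weight_def using assms
  by (intro mult_nonneg_nonneg prod_nonneg) auto

lemma sum_prod_subsets:
  fixes f g :: "'e \<Rightarrow> real"
  assumes "finite P"
  shows "(\<Sum>E\<in>Pow P. (\<Prod>p\<in>E. f p) * (\<Prod>p\<in>P - E. g p)) = (\<Prod>p\<in>P. f p + g p)"
  using prod_add[OF assms] by metis

lemma sum_bernoulli_weight:
  assumes "finite P"
  shows "(\<Sum>E\<in>Pow P. bernoulli_weight P w E) = 1"
  unfolding bernoulli_weight_def by (simp add: sum_prod_subsets[OF assms])

text \<open>Independence: the condition \<open>A \<subseteq> E\<close> is encoded by replacing the
  factor \<open>1 - w p\<close> by \<open>0\<close> for \<open>p\<close> in \<open>A\<close>. The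
  sum then factorises, with factor \<open>w p\<close> on \<open>A\<close> and \<open>1\<close>
  elsewhere.\<close>

lemma sum_bernoulli_weight_supersets:
  assumes "finite P" "A \<subseteq> P"
  shows "(\<Sum>E\<in>Pow P. if A \<subseteq> E then bernoulli_weight P w E else 0) = (\<Prod>p\<in>A. w p)"
proof -
  have "(if A \<subseteq> E then bernoulli_weight P w E else 0) =
      (\<Prod>p\<in>E. w p) * (\<Prod>p\<in>P - E. if p \<in> A then 0 else 1 - w p)" if "E \<in> Pow P" for E
  proof (cases "A \<subseteq> E")
    case True
    then have "(\<Prod>p\<in>P - E. if p \<in> A then 0 else 1 - w p) = (\<Prod>p\<in>P - E. 1 - w p)"
      by (intro prod.cong) auto
    then show ?thesis
      using True by (simp add: bernoulli_weight_def)
  next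
    case False
    then have "\<exists>p\<in>P - E. (if p \<in> A then 0 else 1 - w p) = 0"
      using assms by auto
    then have "(\<Prod>p\<in>P - E. if p \<in> A then 0 else 1 - w p) = 0"
      using assms by (intro prod_zero) auto
    then show ?thesis
      using False by simp
  qed
  then have "(\<Sum>E\<in>Pow P. if A \<subseteq> E then bernoulli_weight P w E else 0) =
      (\<Sum>E\<in>Pow P. (\<Prod>p\<in>E. w p) * (\<Prod>p\<in>P - E. if p \<in> A then 0 else 1 - w p))"
    by (intro sum.cong refl)
  also have "\<dots> = (\<Prod>p\<in>P. w p + (if p \<in> A then 0 else 1 - w p))"
    by (rule sum_prod_subsets[OF assms(1)])
  also have "\<dots> = (\<Prod>p\<in>P. if p \<in> A then w p else 1)"
    by (intro prod.cong) auto
  also have "\<dots> = (\<Prod>p\<in>A. w p)"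
    using assms by (simp add: prod.If_cases Int_absorb1)
  finally show ?thesis .
qed

text \<open>The expectation of a product of independent factors: an element \<open>p\<close> of
  \<open>A\<close> contributes \<open>w p / 2 + (1 - w p)\<close>. This moment drives the tail
  bound.\<close>

lemma sum_bernoulli_weight_half_power:
  assumes "finite P" "A \<subseteq> P"
  shows "(\<Sum>E\<in>Pow P. bernoulli_weight P w E * (1/2) ^ card (E \<inter> A)) = (\<Prod>p\<in>A. 1 - w p / 2)"
proof -
  have "bernoulli_weight P w E * (1/2) ^ card (E \<inter> A) =
      (\<Prod>p\<in>E. w p * (if p \<in> A then 1/2 else 1)) * (\<Prod>p\<in>P - E. 1 - w p)"
    if "E \<in> Pow P" for E
  proof -
    have "finite E"
      using that assms finite_subset by auto
    then have "(\<Prod>p\<in>E. if p \<in> A then 1/2 else (1::real)) = (1/2) ^ card (E \<inter> A)"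
      by (simp add: prod.If_cases)
    then show ?thesis
      by (simp add: bernoulli_weight_def prod.distrib)
  qed
  then have "(\<Sum>E\<in>Pow P. bernoulli_weight P w E * (1/2) ^ card (E \<inter> A)) =
      (\<Prod>p\<in>P. w p * (if p \<in> A then 1/2 else 1) + (1 - w p))"
    by (simp only: sum_prod_subsets[OF assms(1)] cong: sum.cong)
  also have "\<dots> = (\<Prod>p\<in>P. if p \<in> A then 1 - w p / 2 else 1)"
    by (intro prod.cong) (auto simp: field_simps)
  also have "\<dots> = (\<Prod>p\<in>A. 1 - w p / 2)"
    using assms by (simp add: prod.If_cases Int_absorb1)
  finally show ?thesis .
qed

text \<open>Chernoff's method with base \<open>1/2\<close>. Write \<mu> for \<open>sum w A\<close>.
  On the event, \<open>(1/2) ^ card (E \<inter> A)\<close> is at least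
  \<open>exp (- \<mu> / 4)\<close>, because \<open>2 \<le> exp 1\<close>; its expectation is at most
  \<open>exp (- \<mu> / 2)\<close>.\<close>

lemma bernoulli_lower_tail:
  assumes "finite P" "A \<subseteq> P" and w: "\<And>p. p \<in> P \<Longrightarrow> 0 \<le> w p \<and> w p \<le> 1"
  shows "(\<Sum>E | E \<subseteq> P \<and> real (card (E \<inter> A)) \<le> sum w A / 4. bernoulli_weight P w E)
    \<le> exp (- (sum w A / 4))"
proof -
  let ?\<mu> = "sum w A"
  have fA: "finite A"
    using assms finite_subset by auto
  have "(\<Sum>E | E \<subseteq> P \<and> real (card (E \<inter> A)) \<le> ?\<mu> / 4. bernoulli_weight P w E)
      \<le> (\<Sum>E | E \<subseteq> P \<and> real (card (E \<inter> A)) \<le> ?\<mu> / 4.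
          exp (?\<mu> / 4) * (bernoulli_weight P w E * (1/2) ^ card (E \<inter> A)))"
  proof (intro sum_mono)
    fix E assume "E \<in> {E. E \<subseteq> P \<and> real (card (E \<inter> A)) \<le> ?\<mu> / 4}"
    then have E: "E \<subseteq> P" "real (card (E \<inter> A)) \<le> ?\<mu> / 4" by auto
    have "(2::real) ^ card (E \<inter> A) \<le> exp 1 ^ card (E \<inter> A)"
      using exp_ge_add_one_self[of 1] by (intro power_mono) auto
    also have "\<dots> = exp (real (card (E \<inter> A)))"
      by (simp add: exp_of_nat_mult[symmetric])
    also have "\<dots> \<le> exp (?\<mu> / 4)"
      using E by simp
    finally have "1 \<le> exp (?\<mu> / 4) * (1/2) ^ card (E \<inter> A)"
      by (simp add: field_simps power_divide)
    from mult_left_mono[OF this bernoulli_weight_nonneg[OF E(1) w]]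
    show "bernoulli_weight P w E \<le> exp (?\<mu> / 4) * (bernoulli_weight P w E * (1/2) ^ card (E \<inter> A))"
      by (simp add: mult_ac)
  qed
  also have "\<dots> \<le> (\<Sum>E\<in>Pow P. exp (?\<mu> / 4) * (bernoulli_weight P w E * (1/2) ^ card (E \<inter> A)))"
    using assms bernoulli_weight_nonneg[OF _ w]
    by (intro sum_mono2) (auto intro!: mult_nonneg_nonneg)
  also have "\<dots> = exp (?\<mu> / 4) * (\<Prod>p\<in>A. 1 - w p / 2)"
    by (simp only: sum_distrib_left[symmetric] sum_bernoulli_weight_half_power[OF assms(1,2)])
  also have "\<dots> \<le> exp (?\<mu> / 4) * (\<Prod>p\<in>A. exp (- (w p / 2)))"
  proof (intro mult_left_mono prod_mono conjI)
    fix p assume "p \<in> A"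
    then have "w p \<le> 1" using w assms by blast
    then show "0 \<le> 1 - w p / 2" by simp
    show "1 - w p / 2 \<le> exp (- (w p / 2))"
      using exp_ge_add_one_self[of "- (w p / 2)"] by simp
  qed simp
  also have "\<dots> = exp (?\<mu> / 4 - ?\<mu> / 2)"
    using fA by (simp add: exp_sum[symmetric] sum_negf sum_divide_distrib[symmetric] exp_add[symmetric])
  finally show ?thesis by (simp add: field_simps)
qed

section \<open>Local density of the random graph and its expected number of copies of
  \<open>H\<close>\<close>

definition pairs :: "'a set \<Rightarrow> 'a set set" where
  "pairs U = {e. e \<subseteq> U \<and> card e = 2}"

lemma finite_pairs: "finite U \<Longrightarrow> finite (pairs U)"
  unfolding pairs_def by (rule finite_subset[of _ "Pow U"]) auto

text \<open>Every two-element set comes from two ordered pairs. This serves the Cauchy-Schwarz sum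
  below and the degree sum of \<open>G\<close>.\<close>

lemma sum_off_diagonal:
  fixes g :: "'a set \<Rightarrow> real"
  assumes "finite U"
  shows "(\<Sum>i\<in>U. \<Sum>j\<in>U - {i}. g {i, j}) = 2 * (\<Sum>e\<in>pairs U. g e)"
proof -
  let ?D = "SIGMA i:U. U - {i}"
  have "(\<Sum>i\<in>U. \<Sum>j\<in>U - {i}. g {i, j}) = (\<Sum>(i, j)\<in>?D. g {i, j})"
    using assms by (intro sum.Sigma) auto
  also have "\<dots> = (\<Sum>e\<in>pairs U. \<Sum>p | p \<in> ?D \<and> {fst p, snd p} = e. g {fst p, snd p})"
    using assms by (subst sum.group)
      (auto simp: finite_pairs case_prod_beta pairs_def)
  also have "\<dots> = (\<Sum>e\<in>pairs U. 2 * g e)"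
  proof (intro sum.cong refl)
    fix e assume "e \<in> pairs U"
    then obtain i j where e: "e = {i, j}" "i \<noteq> j" "i \<in> U" "j \<in> U"
      by (auto simp: pairs_def card_2_iff)
    then have "{p. p \<in> ?D \<and> {fst p, snd p} = e} = {(i, j), (j, i)}"
      by (auto simp: doubleton_eq_iff)
    then show "(\<Sum>p | p \<in> ?D \<and> {fst p, snd p} = e. g {fst p, snd p}) = 2 * g e"
      using e by (simp add: insert_commute)
  qed
  also have "\<dots> = 2 * (\<Sum>e\<in>pairs U. g e)"
    by (simp add: sum_distrib_left)
  finally show ?thesis .
qed

text \<open>The union bound for a nonnegative weight.\<close>

lemma sum_UN_le:
  fixes f :: "'b \<Rightarrow> real"
  assumes "finite I" "\<And>i. i \<in> I \<Longrightarrow> finite (A i)" "\<And>i x. i \<in> I \<Longrightarrow> x \<in> A i \<Longrightarrow> 0 \<le> f x"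
  shows "sum f (\<Union>i\<in>I. A i) \<le> (\<Sum>i\<in>I. sum f (A i))"
  using assms
proof (induction I rule: finite_induct)
  case (insert i I)
  have "0 \<le> sum f (A i \<inter> (\<Union>i\<in>I. A i))"
    using insert.prems by (intro sum_nonneg) auto
  moreover have "sum f (\<Union>i\<in>I. A i) \<le> (\<Sum>i\<in>I. sum f (A i))"
    using insert.prems by (intro insert.IH) auto
  ultimately show ?case
    using insert.hyps insert.prems by (simp add: sum_Un)
qed simp

text \<open>The tail bound and a union bound over at most \<open>2 ^ N\<close> sets
  \<open>U\<close>. The factor \<open>4\<close> in \<open>dense\<close> turns a quarter of the mean
  into density \<open>d\<close>; the means in \<open>large\<close> push each failure probability
  below \<open>(1/2) ^ (N + 1)\<close>.\<close>

lemma random_graph_locally_dense: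
  assumes w: "\<And>p. p \<in> pairs {..<N} \<Longrightarrow> 0 \<le> w p \<and> w p \<le> (1::real)"
    and dense: "\<And>U. U \<subseteq> {..<N} \<Longrightarrow> \<rho> * real N \<le> real (card U) \<Longrightarrow>
      4 * d * real (card U choose 2) \<le> sum w (pairs U)"
    and large: "\<And>U. U \<subseteq> {..<N} \<Longrightarrow> \<rho> * real N \<le> real (card U) \<Longrightarrow>
      4 * (real N + 1) \<le> sum w (pairs U)"
  shows "(\<Sum>E | E \<subseteq> pairs {..<N} \<and> locally_dense \<rho> d \<lparr>verts = {..<N}, edges = E\<rparr>.
    bernoulli_weight (pairs {..<N}) w E) \<ge> 1/2"
proof -
  let ?P = "pairs {..<N}" and ?b = "bernoulli_weight (pairs {..<N}) w"
  let ?good = "{E. E \<subseteq> ?P \<and> locally_dense \<rho> d \<lparr>verts = {..<N}, edges = E\<rparr>}"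
  let ?Us = "{U. U \<subseteq> {..<N} \<and> \<rho> * real N \<le> real (card U)}"
  let ?bad = "\<lambda>U. {E. E \<subseteq> ?P \<and> real (card (E \<inter> pairs U)) \<le> sum w (pairs U) / 4}"
  have fP: "finite ?P" by (simp add: finite_pairs)
  have fUs: "finite ?Us" by (rule finite_subset[of _ "Pow {..<N}"]) auto
  have fb: "finite (?bad U)" for U by (rule finite_subset[of _ "Pow ?P"]) (use fP in auto)
  have fg: "finite ?good" by (rule finite_subset[of _ "Pow ?P"]) (use fP in auto)
  have nonneg: "0 \<le> ?b E" if "E \<subseteq> ?P" for E
    using bernoulli_weight_nonneg[OF that w] .
  \<comment> \<open>If local density fails at \<open>U\<close>, then \<open>E\<close> has fewer than
    \<open>d * (card U choose 2)\<close> edges inside \<open>U\<close>, hence at most a quarter of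
    the mean.\<close>
  have cover: "Pow ?P \<subseteq> ?good \<union> (\<Union>U\<in>?Us. ?bad U)"
  proof
    fix E assume "E \<in> Pow ?P"
    then have E: "E \<subseteq> ?P" by auto
    show "E \<in> ?good \<union> (\<Union>U\<in>?Us. ?bad U)"
    proof (cases "E \<in> ?good")
      case False
      then obtain U where U: "U \<subseteq> {..<N}" "\<rho> * real N \<le> real (card U)"
        and lt: "real (card {e \<in> E. e \<subseteq> U}) < d * real (card U choose 2)"
        using E by (auto simp: locally_dense_def not_le)
      have "{e \<in> E. e \<subseteq> U} = E \<inter> pairs U"
        using E by (auto simp: pairs_def)
      then have "E \<in> ?bad U"
        using lt dense[OF U] E by auto
      then show ?thesis using U by blast
    qed auto
  qed
  have tail: "sum ?b (?bad U) \<le> (1/2) ^ (N + 1)" if "U \<in> ?Us" for U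
  proof -
    have U: "U \<subseteq> {..<N}" "\<rho> * real N \<le> real (card U)" using that by auto
    have "sum ?b (?bad U) \<le> exp (- (sum w (pairs U) / 4))"
      using U by (intro bernoulli_lower_tail fP w) (auto simp: pairs_def)
    also have "\<dots> \<le> exp (- real (N + 1))"
      using large[OF U] by simp
    also have "\<dots> = exp (-1) ^ (N + 1)"
      by (simp only: exp_of_nat_mult[symmetric]) simp
    also have "\<dots> \<le> (1/2) ^ (N + 1)"
      using exp_ge_add_one_self[of 1] by (intro power_mono) (auto simp: exp_minus field_simps)
    finally show ?thesis .
  qed
  have "1 = sum ?b (Pow ?P)"
    using sum_bernoulli_weight[OF fP] by simp
  also have "\<dots> \<le> sum ?b (?good \<union> (\<Union>U\<in>?Us. ?bad U))"
    using cover fUs fb fg nonneg by (intro sum_mono2) auto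
  also have "\<dots> \<le> sum ?b ?good + sum ?b (\<Union>U\<in>?Us. ?bad U)"
  proof -
    have "0 \<le> sum ?b (?good \<inter> (\<Union>U\<in>?Us. ?bad U))"
      using nonneg by (intro sum_nonneg) auto
    moreover have "finite (\<Union>U\<in>?Us. ?bad U)"
      using fUs fb by blast
    ultimately show ?thesis
      using fg by (simp add: sum_Un)
  qed
  also have "sum ?b (\<Union>U\<in>?Us. ?bad U) \<le> (\<Sum>U\<in>?Us. sum ?b (?bad U))"
    using fUs fb nonneg by (intro sum_UN_le) auto
  also have "\<dots> \<le> (\<Sum>U\<in>?Us. (1/2) ^ (N + 1))"
    using tail by (intro sum_mono) auto
  also have "\<dots> \<le> 2 ^ N * (1/2) ^ (N + 1)"
  proof -
    have "card ?Us \<le> card (Pow {..<N})"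
      by (intro card_mono) auto
    then have "real (card ?Us) \<le> real (2 ^ N)"
      by (simp only: card_Pow finite_lessThan card_lessThan of_nat_le_iff)
    then have "real (card ?Us) * (1/2) ^ (N + 1) \<le> 2 ^ N * (1/2) ^ (N + 1)"
      by (intro mult_right_mono) auto
    then show ?thesis by simp
  qed
  also have "\<dots> = 1/2"
    by (simp add: power_divide)
  finally show ?thesis by simp
qed

text \<open>First moment: graphs of total probability at least \<open>1/2\<close> have at least
  \<open>B\<close> copies each, so the expectation is at least \<open>B / 2\<close>. By linearity it
  is the sum over injective maps of the probability that all image edges are present.\<close>

lemma expected_labeled_copies:
  assumes H: "simple_graph H"
    and w: "\<And>p. p \<in> pairs {..<N} \<Longrightarrow> 0 \<le> w p \<and> w p \<le> (1::real)"
    and likely: "(\<Sum>E | E \<subseteq> pairs {..<N} \<and> locally_dense \<rho> d \<lparr>verts = {..<N}, edges = E\<rparr>.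
      bernoulli_weight (pairs {..<N}) w E) \<ge> 1/2"
    and many: "\<And>G :: nat ugraph. simple_graph G \<Longrightarrow> card (verts G) = N \<Longrightarrow> locally_dense \<rho> d G \<Longrightarrow>
      B \<le> real (card (labeled_copies H G))"
    and "0 \<le> B"
  shows "B / 2 \<le> (\<Sum>\<phi> | \<phi> \<in> verts H \<rightarrow>\<^sub>E {..<N} \<and> inj_on \<phi> (verts H). \<Prod>e\<in>edges H. w (\<phi> ` e))"
proof -
  let ?P = "pairs {..<N}" and ?b = "bernoulli_weight (pairs {..<N}) w"
  let ?G = "\<lambda>E. \<lparr>verts = {..<N}, edges = E\<rparr>"
  let ?good = "{E. E \<subseteq> ?P \<and> locally_dense \<rho> d (?G E)}"
  let ?I = "{\<phi>. \<phi> \<in> verts H \<rightarrow>\<^sub>E {..<N} \<and> inj_on \<phi> (verts H)}"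
  have fP: "finite ?P" by (simp add: finite_pairs)
  have fV: "finite (verts H)" using H by (simp add: simple_graph_def)
  have fI: "finite ?I"
    by (rule finite_subset[of _ "verts H \<rightarrow>\<^sub>E {..<N}"]) (auto intro!: finite_PiE fV)
  have nonneg: "0 \<le> ?b E" if "E \<subseteq> ?P" for E
    using bernoulli_weight_nonneg[OF that w] .
  have copies: "real (card (labeled_copies H (?G E))) = (\<Sum>\<phi>\<in>?I. if (`) \<phi> ` edges H \<subseteq> E then 1 else 0)" for E
  proof -
    have "labeled_copies H (?G E) = {\<phi> \<in> ?I. (`) \<phi> ` edges H \<subseteq> E}"
      by (auto simp: labeled_copies_def homs_def)
    then show ?thesis
      using fI by (simp add: sum.If_cases Int_def)
  qed
  have "B / 2 \<le> B * sum ?b ?good"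
    using mult_left_mono[OF likely \<open>0 \<le> B\<close>] by simp
  also have "\<dots> = (\<Sum>E\<in>?good. ?b E * B)"
    by (simp add: sum_distrib_left mult.commute)
  also have "\<dots> \<le> (\<Sum>E\<in>?good. ?b E * real (card (labeled_copies H (?G E))))"
    using nonneg
    by (intro sum_mono mult_left_mono many) (auto simp: simple_graph_def pairs_def)
  also have "\<dots> \<le> (\<Sum>E\<in>Pow ?P. ?b E * real (card (labeled_copies H (?G E))))"
    using nonneg fP by (intro sum_mono2) auto
  also have "\<dots> = (\<Sum>E\<in>Pow ?P. \<Sum>\<phi>\<in>?I. if (`) \<phi> ` edges H \<subseteq> E then ?b E else 0)"
    unfolding copies sum_distrib_left by (intro sum.cong refl) auto
  also have "\<dots> = (\<Sum>\<phi>\<in>?I. \<Sum>E\<in>Pow ?P. if (`) \<phi> ` edges H \<subseteq> E then ?b E else 0)"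
    by (rule sum.swap)
  also have "\<dots> = (\<Sum>\<phi>\<in>?I. \<Prod>e\<in>edges H. w (\<phi> ` e))"
  proof (intro sum.cong refl)
    fix \<phi> assume "\<phi> \<in> ?I"
    then have \<phi>: "\<phi> \<in> verts H \<rightarrow>\<^sub>E {..<N}" "inj_on \<phi> (verts H)" by auto
    have sub: "(`) \<phi> ` edges H \<subseteq> ?P"
    proof
      fix p assume "p \<in> (`) \<phi> ` edges H"
      then obtain e where e: "e \<in> edges H" "p = \<phi> ` e" by auto
      then have "e \<subseteq> verts H" "card e = 2"
        using H by (auto simp: simple_graph_def)
      then show "p \<in> ?P"
        using e \<phi> card_image[OF inj_on_subset[OF \<phi>(2)], of e] by (auto simp: pairs_def)
    qed
    \<comment> \<open>Distinct edges of \<open>H\<close> go to distinct pairs, so the probability of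
      the image set is a product over \<open>edges H\<close> without repetitions.\<close>
    have "inj_on \<phi> (\<Union>(edges H))"
      using \<phi>(2) by (rule inj_on_subset) (use H in \<open>auto simp: simple_graph_def\<close>)
    then have "inj_on ((`) \<phi>) (edges H)"
      by (rule inj_on_image)
    then show "(\<Sum>E\<in>Pow ?P. if (`) \<phi> ` edges H \<subseteq> E then ?b E else 0) = (\<Prod>e\<in>edges H. w (\<phi> ` e))"
      using sum_bernoulli_weight_supersets[OF fP sub, of w] by (simp add: prod.reindex)
  qed
  finally show ?thesis .
qed

subsection \<open>Codegree weights\<close>

text \<open>For a singleton \<open>T\<close> this is the degree, for a two-element \<open>T\<close>
  the codegree.\<close>

definition common_degree :: "'b set \<Rightarrow> ('v \<Rightarrow> 'b \<Rightarrow> bool) \<Rightarrow> 'v set \<Rightarrow> nat" where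
  "common_degree Z R T = card {z \<in> Z. \<forall>x\<in>T. R x z}"

lemma common_degree_antimono:
  assumes "finite Z" "S \<subseteq> T"
  shows "common_degree Z R T \<le> common_degree Z R S"
  unfolding common_degree_def using assms by (intro card_mono) auto

text \<open>The edge probability for sample indices, where \<tau> sends an index to its vertex. The
  denominator runs over indices, so two samples of the same vertex still contribute the square of
  its degree.\<close>

definition codegree_weight ::
  "real \<Rightarrow> 'b set \<Rightarrow> ('v \<Rightarrow> 'b \<Rightarrow> bool) \<Rightarrow> ('i \<Rightarrow> 'v) \<Rightarrow> 'i set \<Rightarrow> real" where
  "codegree_weight l Z R \<tau> e =
     l * real (common_degree Z R (\<tau> ` e)) / (\<Prod>i\<in>e. real (common_degree Z R {\<tau> i}))"

text \<open>The codegree is at most one of the two degrees, and \<open>l\<close> is at most the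
  other.\<close>

lemma codegree_weight_bounds:
  assumes "finite Z" "0 < l" "e \<in> pairs U"
    and "\<And>i. i \<in> U \<Longrightarrow> l \<le> real (common_degree Z R {\<tau> i})"
  shows "0 \<le> codegree_weight l Z R \<tau> e \<and> codegree_weight l Z R \<tau> e \<le> 1"
proof
  show "0 \<le> codegree_weight l Z R \<tau> e"
    using assms(2) by (simp add: codegree_weight_def prod_nonneg)
  obtain i j where e: "e = {i, j}" "i \<noteq> j" "i \<in> U" "j \<in> U"
    using assms(3) by (auto simp: pairs_def card_2_iff)
  have "l \<le> real (common_degree Z R {\<tau> i})" "l \<le> real (common_degree Z R {\<tau> j})"
    using assms(4) e by auto
  moreover have "common_degree Z R {\<tau> i, \<tau> j} \<le> common_degree Z R {\<tau> j}"
    using assms(1) by (intro common_degree_antimono) auto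
  ultimately show "codegree_weight l Z R \<tau> e \<le> 1"
    using assms(2) e by (simp add: codegree_weight_def divide_le_eq mult_mono)
qed

text \<open>Each sample spreads mass \<open>1\<close> evenly over its neighbours in
  \<open>Z\<close>. The total mass is \<open>card U\<close>, and the squared masses at the points of
  \<open>Z\<close> add up to the normalised codegrees of all ordered pairs, so Cauchy-Schwarz
  applies. The subtracted \<open>card U\<close> pays for the diagonal.\<close>

lemma sum_codegree_weight_ge:
  assumes "finite Z" "finite U" "0 < l"
    and deg: "\<And>i. i \<in> U \<Longrightarrow> l \<le> real (common_degree Z R {\<tau> i})"
  shows "l / real (card Z) * (real (card U))\<^sup>2 - real (card U)
    \<le> 2 * (\<Sum>e\<in>pairs U. codegree_weight l Z R \<tau> e)"
proof -
  let ?d = "\<lambda>i. real (common_degree Z R {\<tau> i})"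
  let ?g = "\<lambda>i j. real (common_degree Z R {\<tau> i, \<tau> j}) / (?d i * ?d j)"
  let ?h = "\<lambda>z i. (if R (\<tau> i) z then 1 / ?d i else 0)"
  have pos: "0 < ?d i" if "i \<in> U" for i
    using deg[OF that] assms(3) by linarith
  have "(\<Sum>z\<in>Z. \<Sum>i\<in>U. ?h z i) = (\<Sum>i\<in>U. \<Sum>z\<in>Z. ?h z i)"
    by (rule sum.swap)
  also have "\<dots> = (\<Sum>i\<in>U. 1)"
  proof (intro sum.cong refl)
    fix i assume "i \<in> U"
    have "(\<Sum>z\<in>Z. ?h z i) = ?d i * (1 / ?d i)"
      using assms(1) by (simp add: sum.If_cases common_degree_def Int_def)
    then show "(\<Sum>z\<in>Z. ?h z i) = 1"
      using pos[OF \<open>i \<in> U\<close>] by simp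
  qed
  finally have total: "(\<Sum>z\<in>Z. \<Sum>i\<in>U. ?h z i) = real (card U)"
    by simp
  have "(\<Sum>i\<in>U. \<Sum>j\<in>U. ?g i j) = (\<Sum>i\<in>U. \<Sum>j\<in>U. \<Sum>z\<in>Z. ?h z i * ?h z j)"
  proof (intro sum.cong refl)
    fix i j
    have "(\<Sum>z\<in>Z. ?h z i * ?h z j) = (\<Sum>z\<in>Z. if \<forall>x\<in>{\<tau> i, \<tau> j}. R x z then 1 / (?d i * ?d j) else 0)"
      by (intro sum.cong) auto
    also have "\<dots> = ?g i j"
      using assms(1) by (simp add: sum.If_cases common_degree_def Int_def)
    finally show "?g i j = (\<Sum>z\<in>Z. ?h z i * ?h z j)" by simp
  qed
  also have "\<dots> = (\<Sum>i\<in>U. \<Sum>z\<in>Z. \<Sum>j\<in>U. ?h z i * ?h z j)"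
    by (intro sum.cong refl) (rule sum.swap)
  also have "\<dots> = (\<Sum>z\<in>Z. \<Sum>i\<in>U. \<Sum>j\<in>U. ?h z i * ?h z j)"
    by (rule sum.swap)
  also have "\<dots> = (\<Sum>z\<in>Z. (\<Sum>i\<in>U. ?h z i)\<^sup>2)"
    by (simp only: power2_eq_square sum_product)
  finally have squares: "(\<Sum>i\<in>U. \<Sum>j\<in>U. ?g i j) = (\<Sum>z\<in>Z. (\<Sum>i\<in>U. ?h z i)\<^sup>2)" .
  have "(real (card U))\<^sup>2 \<le> (\<Sum>z\<in>Z. (\<Sum>i\<in>U. ?h z i)\<^sup>2) * real (card Z)"
    using sum_squared_le_sum_of_squares[of "\<lambda>z. \<Sum>i\<in>U. ?h z i" Z] total by simp
  \<comment> \<open>For empty \<open>Z\<close> the quotient is \<open>0\<close> by the convention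
    for division by zero.\<close>
  then have "(real (card U))\<^sup>2 / real (card Z) \<le> (\<Sum>i\<in>U. \<Sum>j\<in>U. ?g i j)"
    unfolding squares by (cases "card Z = 0") (simp_all add: divide_le_eq sum_nonneg)
  from mult_left_mono[OF this, of l]
  have "l / real (card Z) * (real (card U))\<^sup>2 \<le> (\<Sum>i\<in>U. \<Sum>j\<in>U. l * ?g i j)"
    using assms(3) by (simp add: sum_distrib_left)
  also have "\<dots> = (\<Sum>i\<in>U. l * ?g i i) + (\<Sum>i\<in>U. \<Sum>j\<in>U - {i}. l * ?g i j)"
    unfolding sum.distrib[symmetric] using assms(2) by (intro sum.cong refl sum.remove)
  \<comment> \<open>A diagonal term is \<open>l\<close> divided by the degree, hence at most
    \<open>1\<close>.\<close>
  also have "(\<Sum>i\<in>U. l * ?g i i) \<le> (\<Sum>i\<in>U. 1)"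
    using deg pos by (intro sum_mono) (simp add: divide_le_eq)
  also have "(\<Sum>i\<in>U. \<Sum>j\<in>U - {i}. l * ?g i j) = (\<Sum>i\<in>U. \<Sum>j\<in>U - {i}. codegree_weight l Z R \<tau> {i, j})"
    by (intro sum.cong refl) (auto simp: codegree_weight_def)
  finally show ?thesis
    by (simp add: sum_off_diagonal[OF assms(2)])
qed

section \<open>Sampling vertices with prescribed multiplicities\<close>

lemma sum_PiE_compose:
  fixes F :: "('a \<Rightarrow> 'v) \<Rightarrow> real"
  assumes "finite A" "finite I" "finite X" "\<tau> ` I \<subseteq> X"
  shows "(\<Sum>\<phi>\<in>A \<rightarrow>\<^sub>E I. F (restrict (\<tau> \<circ> \<phi>) A)) =
    (\<Sum>\<psi>\<in>A \<rightarrow>\<^sub>E X. (\<Prod>v\<in>A. real (card {i \<in> I. \<tau> i = \<psi> v})) * F \<psi>)"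
proof -
  let ?c = "\<lambda>\<phi>. restrict (\<tau> \<circ> \<phi>) A"
  have "(\<Sum>\<phi>\<in>A \<rightarrow>\<^sub>E I. F (?c \<phi>)) = (\<Sum>\<psi>\<in>A \<rightarrow>\<^sub>E X. \<Sum>\<phi> | \<phi> \<in> A \<rightarrow>\<^sub>E I \<and> ?c \<phi> = \<psi>. F (?c \<phi>))"
    using assms by (subst sum.group) (auto intro!: finite_PiE simp: PiE_iff)
  also have "\<dots> = (\<Sum>\<psi>\<in>A \<rightarrow>\<^sub>E X. (\<Prod>v\<in>A. real (card {i \<in> I. \<tau> i = \<psi> v})) * F \<psi>)"
  proof (intro sum.cong refl)
    fix \<psi> assume \<psi>: "\<psi> \<in> A \<rightarrow>\<^sub>E X"
    \<comment> \<open>The maps \<phi> lying over \<psi> are chosen independently at each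
      \<open>v\<close>, from the fibre of \<tau> over \<open>\<psi> v\<close>.\<close>
    have "{\<phi>. \<phi> \<in> A \<rightarrow>\<^sub>E I \<and> ?c \<phi> = \<psi>} = PiE A (\<lambda>v. {i \<in> I. \<tau> i = \<psi> v})"
    proof (intro equalityI subsetI)
      fix \<phi> assume "\<phi> \<in> PiE A (\<lambda>v. {i \<in> I. \<tau> i = \<psi> v})"
      then show "\<phi> \<in> {\<phi>. \<phi> \<in> A \<rightarrow>\<^sub>E I \<and> ?c \<phi> = \<psi>}"
        using \<psi> by (auto simp: PiE_iff fun_eq_iff extensional_def)
    qed (auto simp: PiE_iff)
    then have "card {\<phi>. \<phi> \<in> A \<rightarrow>\<^sub>E I \<and> ?c \<phi> = \<psi>} = (\<Prod>v\<in>A. card {i \<in> I. \<tau> i = \<psi> v})"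
      using assms(1) by (simp add: card_PiE)
    then show "(\<Sum>\<phi> | \<phi> \<in> A \<rightarrow>\<^sub>E I \<and> ?c \<phi> = \<psi>. F (?c \<phi>)) =
        (\<Prod>v\<in>A. real (card {i \<in> I. \<tau> i = \<psi> v})) * F \<psi>"
      by simp
  qed
  finally show ?thesis .
qed

text \<open>Every point of the union occurs in at least one \<open>e\<close>, and repeated factors
  are at least \<open>1\<close>. It is applied to the edges of a graph without isolated
  vertices.\<close>

lemma prod_Union_le:
  fixes r :: "'a \<Rightarrow> real"
  assumes "finite F" "\<And>e. e \<in> F \<Longrightarrow> finite e" "\<And>x. x \<in> \<Union>F \<Longrightarrow> 1 \<le> r x"
  shows "(\<Prod>x\<in>\<Union>F. r x) \<le> (\<Prod>e\<in>F. \<Prod>x\<in>e. r x)"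
  using assms
proof (induction F rule: finite_induct)
  case (insert e F)
  have IH: "(\<Prod>x\<in>\<Union>F. r x) \<le> (\<Prod>e\<in>F. \<Prod>x\<in>e. r x)"
    using insert.prems by (intro insert.IH) auto
  have "(\<Prod>x\<in>\<Union>(insert e F). r x) = (\<Prod>x\<in>\<Union>F - e. r x) * (\<Prod>x\<in>e. r x)"
    using insert by (subst prod.union_disjoint[symmetric]) (auto intro!: prod.cong)
  also have "\<dots> \<le> (\<Prod>e\<in>F. \<Prod>x\<in>e. r x) * (\<Prod>x\<in>e. r x)"
  proof (rule mult_right_mono)
    have "(\<Prod>x\<in>\<Union>F - e. r x) \<le> (\<Prod>x\<in>\<Union>F. r x)"
    proof (rule prod_mono2)
      show "finite (\<Union>F)" using insert by auto
      show "1 \<le> r b" if "b \<in> \<Union>F - (\<Union>F - e)" for b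
        using insert.prems(2) that by auto
      show "0 \<le> r a" if "a \<in> \<Union>F - e" for a
        using insert.prems(2)[of a] that by fastforce
    qed auto
    with IH show "(\<Prod>x\<in>\<Union>F - e. r x) \<le> (\<Prod>e\<in>F. \<Prod>x\<in>e. r x)" by linarith
    have "0 \<le> r x" if "x \<in> e" for x
      using insert.prems(2)[of x] that by simp
    then show "0 \<le> (\<Prod>x\<in>e. r x)" by (rule prod_nonneg)
  qed
  also have "\<dots> = (\<Prod>e\<in>insert e F. \<Prod>x\<in>e. r x)"
    using insert.hyps by (simp add: mult.commute)
  finally show ?case .
qed simp

text \<open>Enumerate the disjoint union of blocks of size \<open>h x\<close> and project to
  \<open>x\<close>. The sample is thus a fixed list with exact multiplicities; only the edges are
  random.\<close>

lemma ex_map_with_fibres: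
  fixes h :: "'v \<Rightarrow> nat"
  assumes "finite X"
  obtains \<tau> :: "nat \<Rightarrow> 'v" where "\<tau> ` {..<sum h X} \<subseteq> X"
    "\<And>x. x \<in> X \<Longrightarrow> card {i \<in> {..<sum h X}. \<tau> i = x} = h x"
proof -
  let ?S = "SIGMA x:X. {..<h x}"
  have "card ?S = sum h X"
    using assms by simp
  then obtain \<beta> where \<beta>: "bij_betw \<beta> {..<sum h X} ?S"
    using ex_bij_betw_nat_finite[of ?S] assms by (auto simp: atLeast0LessThan)
  show thesis
  proof (rule that[of "fst \<circ> \<beta>"])
    show "(fst \<circ> \<beta>) ` {..<sum h X} \<subseteq> X"
      unfolding image_comp[symmetric] bij_betw_imp_surj_on[OF \<beta>] by auto
    fix x assume x: "x \<in> X"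
    have "bij_betw \<beta> {i \<in> {..<sum h X}. (fst \<circ> \<beta>) i = x} (Pair x ` {..<h x})"
    proof (rule bij_betw_subset[OF \<beta>])
      show "\<beta> ` {i \<in> {..<sum h X}. (fst \<circ> \<beta>) i = x} = Pair x ` {..<h x}"
      proof (intro equalityI subsetI)
        fix p assume "p \<in> \<beta> ` {i \<in> {..<sum h X}. (fst \<circ> \<beta>) i = x}"
        then obtain i where "i < sum h X" "fst (\<beta> i) = x" "p = \<beta> i" by auto
        moreover from this have "\<beta> i \<in> ?S"
          using \<beta> by (auto simp: bij_betw_def)
        ultimately show "p \<in> Pair x ` {..<h x}"
          by (cases p) auto
      next
        fix p assume p: "p \<in> Pair x ` {..<h x}"
        then have "p \<in> \<beta> ` {..<sum h X}"
          using x bij_betw_imp_surj_on[OF \<beta>] by auto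
        then obtain i where "i < sum h X" "p = \<beta> i" by auto
        then show "p \<in> \<beta> ` {i \<in> {..<sum h X}. (fst \<circ> \<beta>) i = x}"
          using p by (intro image_eqI[of _ _ i]) auto
      qed
    qed auto
    then show "card {i \<in> {..<sum h X}. (fst \<circ> \<beta>) i = x} = h x"
      by (auto dest!: bij_betw_same_card simp: card_image inj_on_def)
  qed
qed

definition star_count ::
  "'a set \<Rightarrow> 'a set set \<Rightarrow> 'v set \<Rightarrow> 'z set \<Rightarrow> ('v \<Rightarrow> 'z \<Rightarrow> bool) \<Rightarrow> real" where
  "star_count A F V Z R = (\<Sum>\<phi>\<in>A \<rightarrow>\<^sub>E V. \<Prod>e\<in>F. real (common_degree Z R (\<phi> ` e)))"

lemma simple_graph_edges_finite: "simple_graph H \<Longrightarrow> finite (edges H)"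
  by (rule finite_subset[of _ "Pow (verts H)"]) (auto simp: simple_graph_def)

lemma star_count_mono:
  assumes "finite A" "finite V" "X \<subseteq> V"
  shows "star_count A F X Z R \<le> star_count A F V Z R"
  unfolding star_count_def
proof (rule sum_mono2)
  show "finite (A \<rightarrow>\<^sub>E V)" using assms by (simp add: finite_PiE)
  show "(A \<rightarrow>\<^sub>E X) \<subseteq> (A \<rightarrow>\<^sub>E V)" using assms by (intro PiE_mono) auto
qed (simp add: prod_nonneg)

text \<open>The vertices of degree below \<open>l\<close> carry at most \<open>card V * l\<close>,
  which is at most half of the total.\<close>

lemma sum_large_degrees:
  fixes deg :: "'v \<Rightarrow> nat"
  assumes "finite V" "real (card V) * l \<le> real (sum deg V) / 2"
  shows "real (sum deg V) / 2 \<le> real (sum deg {x \<in> V. l \<le> real (deg x)})"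
proof -
  let ?X = "{x \<in> V. l \<le> real (deg x)}"
  have "real (sum deg V) = real (sum deg ?X) + (\<Sum>x\<in>V - ?X. real (deg x))"
    using assms(1) by (subst sum.subset_diff[of ?X V]) auto
  moreover have "(\<Sum>x\<in>V - ?X. real (deg x)) \<le> (\<Sum>x\<in>V - ?X. max l 0)"
    by (intro sum_mono) auto
  moreover have "(\<Sum>x\<in>V - ?X. max l 0) \<le> real (card V) * max l 0"
    using assms(1) by (auto intro!: mult_right_mono card_mono)
  ultimately show ?thesis
    using assms(2) by (cases "l \<ge> 0") (auto simp: max_def sum_nonneg)
qed

text \<open>The multiplicity of a vertex is proportional to its degree, while every edge at it
  divides by that degree. Since each vertex lies in an edge, the degrees cancel or leave factors at
  most \<open>1\<close>; what remains is a power of \<open>M * l\<close> and the codegrees.\<close>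

lemma sum_weight_le_star_count:
  assumes H: "simple_graph H" "\<Union>(edges H) = verts H"
    and "finite X" "0 < l"
    and deg: "\<And>x. x \<in> X \<Longrightarrow> l \<le> real (common_degree Z R {x})"
    and \<tau>: "\<tau> ` {..<N} \<subseteq> X"
    and fib: "\<And>x. x \<in> X \<Longrightarrow> card {i \<in> {..<N}. \<tau> i = x} = M * common_degree Z R {x}"
  shows "(\<Sum>\<phi> | \<phi> \<in> verts H \<rightarrow>\<^sub>E {..<N :: nat} \<and> inj_on \<phi> (verts H).
      \<Prod>e\<in>edges H. codegree_weight l Z R \<tau> (\<phi> ` e)) * l ^ card (edges H)
    \<le> (real M * l) ^ card (verts H) * star_count (verts H) (edges H) X Z R"
proof -
  let ?A = "verts H" and ?F = "edges H"
  let ?d = "\<lambda>x. real (common_degree Z R {x})"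
  let ?c = "\<lambda>\<psi> e. real (common_degree Z R (\<psi> ` e))"
  let ?w = "\<lambda>\<psi>. \<Prod>e\<in>?F. l * ?c \<psi> e / (\<Prod>x\<in>e. ?d (\<psi> x))"
  have fA: "finite ?A" and fF: "finite ?F" and fe: "\<And>e. e \<in> ?F \<Longrightarrow> finite e"
    and sub: "\<And>e. e \<in> ?F \<Longrightarrow> e \<subseteq> ?A" and two: "\<And>e. e \<in> ?F \<Longrightarrow> card e = 2"
    using H(1) simple_graph_edges_finite[OF H(1)] finite_subset by (auto simp: simple_graph_def)
  have w_nonneg: "0 \<le> ?w \<psi>" for \<psi>
    using \<open>0 < l\<close> by (intro prod_nonneg) (simp add: prod_nonneg)
  have pointwise: "(\<Prod>v\<in>?A. real (card {i \<in> {..<N}. \<tau> i = \<psi> v})) * ?w \<psi> * l ^ card ?F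
      \<le> (real M * l) ^ card ?A * (\<Prod>e\<in>?F. ?c \<psi> e)" if \<psi>: "\<psi> \<in> ?A \<rightarrow>\<^sub>E X" for \<psi>
  proof -
    \<comment> \<open>Degrees are measured in units of \<open>l\<close>, so that all ratios are at
      least \<open>1\<close>.\<close>
    let ?r = "\<lambda>v. ?d (\<psi> v) / l"
    let ?p = "\<Prod>e\<in>?F. \<Prod>x\<in>e. ?r x"
    have X: "\<psi> v \<in> X" if "v \<in> ?A" for v using \<psi> that by auto
    have r: "1 \<le> ?r v" if "v \<in> ?A" for v
      using deg[OF X[OF that]] \<open>0 < l\<close> by simp
    have p: "0 < ?p"
      using r sub by (intro prod_pos) fastforce
    have "(\<Prod>v\<in>?A. real (card {i \<in> {..<N}. \<tau> i = \<psi> v})) = (\<Prod>v\<in>?A. real M * l * ?r v)"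
      using fib X \<open>0 < l\<close> by (intro prod.cong) auto
    also have "\<dots> = (real M * l) ^ card ?A * (\<Prod>v\<in>?A. ?r v)"
      by (subst prod.distrib) (simp only: prod_constant)
    finally have 1: "(\<Prod>v\<in>?A. real (card {i \<in> {..<N}. \<tau> i = \<psi> v})) =
      (real M * l) ^ card ?A * (\<Prod>v\<in>?A. ?r v)" .
    \<comment> \<open>The extra factor gives \<open>l * l\<close> for each edge, one
      \<open>l\<close> for each end, turning both degrees into ratios.\<close>
    have "?w \<psi> * l ^ card ?F = (\<Prod>e\<in>?F. l * ?c \<psi> e / (\<Prod>x\<in>e. ?d (\<psi> x)) * l)"
      by (subst prod.distrib) (simp only: prod_constant)
    also have "\<dots> = (\<Prod>e\<in>?F. ?c \<psi> e / (\<Prod>x\<in>e. ?r x))"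
      using two \<open>0 < l\<close>
      by (intro prod.cong refl) (simp add: prod_dividef power2_eq_square)
    also have "\<dots> = (\<Prod>e\<in>?F. ?c \<psi> e) / ?p"
      by (rule prod_dividef)
    finally have 2: "?w \<psi> * l ^ card ?F = (\<Prod>e\<in>?F. ?c \<psi> e) / ?p" .
    have "(\<Prod>v\<in>?A. ?r v) \<le> ?p"
      using prod_Union_le[of ?F ?r] fF fe r H(2) by auto
    then have "(\<Prod>v\<in>?A. ?r v) / ?p \<le> 1"
      using p by (simp add: divide_le_eq)
    then have "((real M * l) ^ card ?A * (\<Prod>e\<in>?F. ?c \<psi> e)) * ((\<Prod>v\<in>?A. ?r v) / ?p)
        \<le> ((real M * l) ^ card ?A * (\<Prod>e\<in>?F. ?c \<psi> e)) * 1"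
      using \<open>0 < l\<close> by (intro mult_left_mono) (auto intro!: mult_nonneg_nonneg prod_nonneg)
    then show ?thesis
      unfolding mult.assoc[of _ "?w \<psi>"] 1 2 by (simp add: mult_ac)
  qed
  have "(\<Sum>\<phi> | \<phi> \<in> ?A \<rightarrow>\<^sub>E {..<N} \<and> inj_on \<phi> ?A. \<Prod>e\<in>?F. codegree_weight l Z R \<tau> (\<phi> ` e))
      = (\<Sum>\<phi> | \<phi> \<in> ?A \<rightarrow>\<^sub>E {..<N} \<and> inj_on \<phi> ?A. ?w (restrict (\<tau> \<circ> \<phi>) ?A))"
  proof (intro sum.cong prod.cong refl)
    fix \<phi> e assume \<phi>: "\<phi> \<in> {\<phi>. \<phi> \<in> ?A \<rightarrow>\<^sub>E {..<N} \<and> inj_on \<phi> ?A}" and e: "e \<in> ?F"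
    \<comment> \<open>Each edge must contribute two degree factors, even where \<tau> identifies the
      two samples; injectivity of \<phi> ensures this.\<close>
    have "inj_on \<phi> e"
      using \<phi> sub[OF e] by (auto intro: inj_on_subset)
    then have "(\<Prod>i\<in>\<phi> ` e. ?d (\<tau> i)) = (\<Prod>x\<in>e. ?d (restrict (\<tau> \<circ> \<phi>) ?A x))"
      using sub[OF e] by (subst prod.reindex) (auto intro!: prod.cong)
    moreover have "\<tau> ` \<phi> ` e = restrict (\<tau> \<circ> \<phi>) ?A ` e"
      using sub[OF e] by (auto simp: image_iff)
    ultimately show "codegree_weight l Z R \<tau> (\<phi> ` e) =
        l * ?c (restrict (\<tau> \<circ> \<phi>) ?A) e / (\<Prod>x\<in>e. ?d (restrict (\<tau> \<circ> \<phi>) ?A x))"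
      by (simp only: codegree_weight_def)
  qed
  \<comment> \<open>Nonnegative terms allow a sum over all maps, for which the fibre counts
    factorise.\<close>
  also have "\<dots> \<le> (\<Sum>\<phi>\<in>?A \<rightarrow>\<^sub>E {..<N}. ?w (restrict (\<tau> \<circ> \<phi>) ?A))"
    using fA by (intro sum_mono2 w_nonneg) (auto intro: finite_PiE)
  also have "\<dots> = (\<Sum>\<psi>\<in>?A \<rightarrow>\<^sub>E X. (\<Prod>v\<in>?A. real (card {i \<in> {..<N}. \<tau> i = \<psi> v})) * ?w \<psi>)"
    by (rule sum_PiE_compose[OF fA _ \<open>finite X\<close> \<tau>]) simp
  finally have "(\<Sum>\<phi> | \<phi> \<in> ?A \<rightarrow>\<^sub>E {..<N} \<and> inj_on \<phi> ?A. \<Prod>e\<in>?F. codegree_weight l Z R \<tau> (\<phi> ` e)) * l ^ card ?F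
      \<le> (\<Sum>\<psi>\<in>?A \<rightarrow>\<^sub>E X. (\<Prod>v\<in>?A. real (card {i \<in> {..<N}. \<tau> i = \<psi> v})) * ?w \<psi>) * l ^ card ?F"
    using \<open>0 < l\<close> by (intro mult_right_mono) auto
  also have "\<dots> \<le> (\<Sum>\<psi>\<in>?A \<rightarrow>\<^sub>E X. (real M * l) ^ card ?A * (\<Prod>e\<in>?F. ?c \<psi> e))"
    unfolding sum_distrib_right using pointwise by (intro sum_mono)
  also have "\<dots> = (real M * l) ^ card ?A * star_count ?A ?F X Z R"
    by (simp only: star_count_def sum_distrib_left)
  finally show ?thesis .
qed

section \<open>The bound up to a constant factor\<close>

lemma real_choose_two_le: "real (n choose 2) \<le> (real n)\<^sup>2 / 2"
proof -
  have "2 * (n choose 2) \<le> n * (n - 1)"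
    by (simp add: choose_two)
  also have "\<dots> \<le> n * n" by simp
  finally have "real (2 * (n choose 2)) \<le> real (n * n)" by (simp only: of_nat_le_iff)
  then show ?thesis by (simp add: power2_eq_square)
qed

text \<open>The hypothesis on \<open>H\<close>, used at density \<open>q / 16\<close>, bounds the
  expected number of copies in the random graph from below, and \<open>star_count\<close> bounds it
  from above. The lost factor depends only on \<open>a\<close> and \<open>card (edges H)\<close>,
  which is what tensor powers require.\<close>

lemma star_count_ge:
  assumes H: "simple_graph H" "\<Union>(edges H) = verts H"
    and f: "f \<in> {0<..1} \<rightarrow> {0<..1}" and "0 < a"
    and bound: "\<And>d. d \<in> {0<..1} \<Longrightarrow> dense_count_bound H f a d"
    and fin: "finite V" "finite Z"
    and q_def: "q = (\<Sum>x\<in>V. real (common_degree Z R {x})) / (real (card V) * real (card Z))"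
    and "0 < q"
  shows "a / 2 / 32 ^ card (edges H) *
      (real (card V) ^ card (verts H) * real (card Z) ^ card (edges H) * q ^ (2 * card (edges H)))
    \<le> star_count (verts H) (edges H) V Z R"
proof -
  let ?e = "card (edges H)" and ?v = "card (verts H)"
  let ?deg = "\<lambda>x. common_degree Z R {x}"
  \<comment> \<open>Since \<open>codegree \<le> deg\<close>, this choice of \<open>l\<close> makes \<open>l * codegree / (deg * deg)\<close> a probability
    on vertices of degree at least \<open>l\<close>, and these vertices still carry half of the incidences.\<close>
  define n m where "n = real (card V)" and "m = real (card Z)"
  define l d \<rho> where "l = q * m / 2" and "d = q / 16" and "\<rho> = f d"
  define X where "X = {x \<in> V. l \<le> real (?deg x)}"
  \<comment> \<open>As division by zero gives \<open>0\<close>, a positive \<open>q\<close> forces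
    \<open>V\<close> and \<open>Z\<close> to be nonempty.\<close>
  have "n * m \<noteq> 0"
    using \<open>0 < q\<close> unfolding q_def n_def m_def by (metis div_by_0 less_irrefl)
  then have "0 < n" "0 < m" by (auto simp: n_def m_def)
  have total: "real (sum ?deg V) = q * n * m"
    using \<open>0 < n\<close> \<open>0 < m\<close> by (simp add: q_def n_def m_def)
  have "real (sum ?deg V) \<le> n * m"
  proof -
    have "(\<Sum>x\<in>V. real (?deg x)) \<le> (\<Sum>x\<in>V. m)"
      using fin by (intro sum_mono) (auto simp: common_degree_def m_def intro: card_mono)
    then show ?thesis by (simp add: n_def)
  qed
  then have "q * (n * m) \<le> 1 * (n * m)" using total by (simp add: mult.assoc)
  then have "q \<le> 1" using \<open>0 < n\<close> \<open>0 < m\<close> by (simp add: mult_le_cancel_right)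
  have d: "d \<in> {0<..1}" using \<open>0 < q\<close> \<open>q \<le> 1\<close> by (simp add: d_def)
  then have \<rho>: "0 < \<rho>" "\<rho> \<le> 1" using f by (auto simp: \<rho>_def)
  have "0 < l" using \<open>0 < q\<close> \<open>0 < m\<close> by (simp add: l_def)
  have X: "finite X" "X \<subseteq> V" using fin by (auto simp: X_def)
  have large: "real (sum ?deg X) \<ge> q * n * m / 2"
    using sum_large_degrees[of V l ?deg] fin total by (simp add: X_def l_def n_def)
  obtain n\<^sub>0 where n\<^sub>0: "\<And>G :: nat ugraph. simple_graph G \<Longrightarrow> n\<^sub>0 \<le> card (verts G) \<Longrightarrow> locally_dense \<rho> d G \<Longrightarrow>
      a * real (card (verts G)) ^ ?v * d ^ ?e \<le> real (card (labeled_copies H G))"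
    using bound[OF d] unfolding dense_count_bound_def \<rho>_def by blast
  \<comment> \<open>A common multiplier of all multiplicities. It puts the sample size
    \<open>N\<close> above the threshold \<open>n\<^sub>0\<close> and makes
    \<open>q * \<rho>\<^sup>2 * N\<close> at least \<open>64\<close>, enough for the diagonal loss
    and the union bound.\<close>
  define M where "M = max 1 (max n\<^sub>0 (nat \<lceil>64 / (q * \<rho>\<^sup>2)\<rceil>))"
  define N where "N = sum (\<lambda>x. M * ?deg x) X"
  have NM: "N = M * sum ?deg X" by (simp add: N_def sum_distrib_left)
  have "0 < q * n * m / 2" using \<open>0 < q\<close> \<open>0 < n\<close> \<open>0 < m\<close> by simp
  then have "1 \<le> sum ?deg X" using large by linarith
  then have "M \<le> N" by (simp add: NM)
  have N: "n\<^sub>0 \<le> N" "1 \<le> N" "64 / (q * \<rho>\<^sup>2) \<le> real N"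
  proof -
    show "n\<^sub>0 \<le> N" "1 \<le> N" using \<open>M \<le> N\<close> by (auto simp: M_def)
    have "64 / (q * \<rho>\<^sup>2) \<le> real M" unfolding M_def by linarith
    then show "64 / (q * \<rho>\<^sup>2) \<le> real N" using \<open>M \<le> N\<close> by linarith
  qed
  obtain \<tau> :: "nat \<Rightarrow> _" where \<tau>: "\<tau> ` {..<N} \<subseteq> X"
    and fib: "\<And>x. x \<in> X \<Longrightarrow> card {i \<in> {..<N}. \<tau> i = x} = M * ?deg x"
    using that by (rule ex_map_with_fibres[OF X(1), of "\<lambda>x. M * ?deg x", folded N_def])
  let ?w = "codegree_weight l Z R \<tau>"
  have deg\<tau>: "l \<le> real (?deg (\<tau> i))" if "i \<in> {..<N}" for i
    using \<tau> that by (auto simp: X_def)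
  have w: "0 \<le> ?w p \<and> ?w p \<le> 1" if "p \<in> pairs {..<N}" for p
    using codegree_weight_bounds[OF fin(2) \<open>0 < l\<close> that deg\<tau>] .
  have q\<rho>N: "64 \<le> q * \<rho>\<^sup>2 * real N"
    using N(3) \<open>0 < q\<close> \<rho> by (simp add: divide_le_eq mult.commute)
  have dense: "4 * d * real (card U choose 2) \<le> sum ?w (pairs U) \<and> 4 * (real N + 1) \<le> sum ?w (pairs U)"
    if U: "U \<subseteq> {..<N}" "\<rho> * real N \<le> real (card U)" for U
  proof -
    define u where "u = real (card U)"
    have "finite U" using U finite_subset by blast
    then have "l / m * u\<^sup>2 - u \<le> 2 * sum ?w (pairs U)"
      unfolding u_def m_def using U deg\<tau> by (intro sum_codegree_weight_ge[OF fin(2) _ \<open>0 < l\<close>]) auto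
    then have low: "q * u\<^sup>2 / 4 - u / 2 \<le> sum ?w (pairs U)"
      using \<open>0 < m\<close> by (simp add: l_def)
    have u: "\<rho> * real N \<le> u" using U by (simp add: u_def)
    have "64 \<le> \<rho> * (q * \<rho> * real N)"
      using q\<rho>N by (simp add: power2_eq_square mult_ac)
    also have "\<dots> \<le> 1 * (q * \<rho> * real N)"
      using \<rho> \<open>0 < q\<close> by (intro mult_right_mono) auto
    also have "\<dots> = q * (\<rho> * real N)" by simp
    also have "\<dots> \<le> q * u" using u \<open>0 < q\<close> by simp
    finally have "64 \<le> q * u" .
    \<comment> \<open>Hence the diagonal loss \<open>u / 2\<close> is at most half of the main term
      \<open>q * u\<^sup>2 / 4\<close>.\<close>
    then have "4 * u \<le> q * u * u"
      by (intro mult_right_mono) (auto simp: u_def)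
    then have half: "q * u\<^sup>2 / 8 \<le> sum ?w (pairs U)"
      using low by (simp add: power2_eq_square mult.assoc)
    \<comment> \<open>The choice \<open>d = q / 16\<close> is made for this comparison with
      \<open>q * u\<^sup>2 / 8\<close>.\<close>
    have "4 * d * real (card U choose 2) \<le> 4 * d * (u\<^sup>2 / 2)"
      unfolding u_def using d by (intro mult_left_mono real_choose_two_le) auto
    also have "\<dots> = q * u\<^sup>2 / 8" by (simp add: d_def)
    finally have 1: "4 * d * real (card U choose 2) \<le> sum ?w (pairs U)"
      using half by linarith
    have "64 * real N \<le> q * \<rho>\<^sup>2 * real N * real N"
      using q\<rho>N by (intro mult_right_mono) auto
    also have "\<dots> = q * (\<rho> * real N)\<^sup>2" by (simp add: power2_eq_square mult_ac)
    also have "\<dots> \<le> q * u\<^sup>2"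
      using u \<rho> \<open>0 < q\<close> by (intro mult_left_mono power_mono) auto
    finally have "8 * real N \<le> q * u\<^sup>2 / 8" by simp
    also note half
    finally have "8 * real N \<le> sum ?w (pairs U)" .
    then have "4 * (real N + 1) \<le> sum ?w (pairs U)"
      using N(2) by simp
    with 1 show ?thesis by blast
  qed
  have likely: "(\<Sum>E | E \<subseteq> pairs {..<N} \<and> locally_dense \<rho> d \<lparr>verts = {..<N}, edges = E\<rparr>.
      bernoulli_weight (pairs {..<N}) ?w E) \<ge> 1/2"
    using dense by (intro random_graph_locally_dense w) auto
  define S where "S = (\<Sum>\<phi> | \<phi> \<in> verts H \<rightarrow>\<^sub>E {..<N} \<and> inj_on \<phi> (verts H). \<Prod>e\<in>edges H. ?w (\<phi> ` e))"
  have "a * real N ^ ?v * d ^ ?e / 2 \<le> S"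
    unfolding S_def
  proof (rule expected_labeled_copies[OF H(1) w likely])
    show "a * real N ^ ?v * d ^ ?e \<le> real (card (labeled_copies H G))"
      if "simple_graph G" "card (verts G) = N" "locally_dense \<rho> d G" for G :: "nat ugraph"
      using n\<^sub>0[of G] that N(1) by simp
    show "0 \<le> a * real N ^ ?v * d ^ ?e"
      using \<open>0 < a\<close> d by simp
  qed
  then have "a * real N ^ ?v * d ^ ?e / 2 * l ^ ?e \<le> S * l ^ ?e"
    using \<open>0 < l\<close> by (intro mult_right_mono) auto
  also have "\<dots> \<le> (real M * l) ^ ?v * star_count (verts H) (edges H) X Z R"
    unfolding S_def using sum_weight_le_star_count[OF H X(1) \<open>0 < l\<close> _ \<tau> fib]
    by (auto simp: X_def)
  also have "\<dots> \<le> (real M * l) ^ ?v * star_count (verts H) (edges H) V Z R"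
    using H X fin \<open>0 < l\<close> by (intro mult_left_mono star_count_mono) (auto simp: simple_graph_def)
  finally have upper: "a * real N ^ ?v * d ^ ?e / 2 * l ^ ?e
    \<le> (real M * l) ^ ?v * star_count (verts H) (edges H) V Z R" .
  \<comment> \<open>The large degrees carry half of the incidences, so \<open>N\<close> is at least
    \<open>M * l * n\<close>. The powers of \<open>M * l\<close> then cancel, and the bound no
    longer depends on the sample size.\<close>
  have "real M * l * n = real M * (q * n * m / 2)"
    by (simp add: l_def)
  also have "\<dots> \<le> real M * real (sum ?deg X)"
    using large by (intro mult_left_mono) auto
  also have "\<dots> = real N" by (simp only: NM of_nat_mult)
  finally have "(real M * l * n) ^ ?v \<le> real N ^ ?v"
    using \<open>0 < l\<close> \<open>0 < n\<close> by (intro power_mono) auto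
  then have "a / 2 * d ^ ?e * l ^ ?e * (real M * l * n) ^ ?v \<le> a / 2 * d ^ ?e * l ^ ?e * real N ^ ?v"
    using \<open>0 < a\<close> d \<open>0 < l\<close> by (intro mult_left_mono) auto
  also have "\<dots> \<le> (real M * l) ^ ?v * star_count (verts H) (edges H) V Z R"
    using upper by (simp add: mult_ac)
  finally have "(real M * l) ^ ?v * (a / 2 * d ^ ?e * l ^ ?e * n ^ ?v)
    \<le> (real M * l) ^ ?v * star_count (verts H) (edges H) V Z R"
    by (simp add: power_mult_distrib mult_ac)
  moreover have "0 < (real M * l) ^ ?v"
    using \<open>0 < l\<close> by (simp add: M_def)
  ultimately have "a / 2 * d ^ ?e * l ^ ?e * n ^ ?v \<le> star_count (verts H) (edges H) V Z R"
    by simp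
  \<comment> \<open>The constant \<open>32\<close> is \<open>16\<close> from \<open>d\<close> times
    \<open>2\<close> from \<open>l\<close>.\<close>
  moreover have "d ^ ?e * l ^ ?e = (q\<^sup>2 * m / 32) ^ ?e"
    unfolding power_mult_distrib[symmetric] by (simp add: d_def l_def power2_eq_square mult_ac)
  ultimately show ?thesis
    unfolding n_def m_def power_mult by (simp add: power_mult_distrib power_divide mult_ac)
qed

subsection \<open>Tensor powers\<close>

text \<open>A common neighbour in the power is chosen coordinate by coordinate.\<close>

lemma common_degree_power:
  "common_degree ({..<k} \<rightarrow>\<^sub>E Z) (\<lambda>x z. \<forall>i<k. R (x i) (z i)) T =
    (\<Prod>i<k :: nat. common_degree Z R ((\<lambda>x. x i) ` T))"
proof -
  have "{z \<in> {..<k} \<rightarrow>\<^sub>E Z. \<forall>x\<in>T. \<forall>i<k. R (x i) (z i)} =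
      PiE {..<k} (\<lambda>i. {z \<in> Z. \<forall>x\<in>(\<lambda>x. x i) ` T. R x z})"
    by (auto simp: PiE_iff extensional_def)
  then show ?thesis
    by (simp add: common_degree_def card_PiE)
qed

text \<open>A map into the power is a \<open>k\<close>-tuple of maps, and its contribution is the
  product of theirs.\<close>

lemma star_count_power:
  assumes "finite A" "finite V" "\<Union>F \<subseteq> A"
  shows "star_count A F ({..<k} \<rightarrow>\<^sub>E V) ({..<k} \<rightarrow>\<^sub>E Z) (\<lambda>x z. \<forall>i<k. R (x i) (z i)) =
    star_count A F V Z R ^ k"
proof -
  let ?c = "\<lambda>\<phi>. \<Prod>e\<in>F. real (common_degree Z R (\<phi> ` e))"
  have "star_count A F ({..<k} \<rightarrow>\<^sub>E V) ({..<k} \<rightarrow>\<^sub>E Z) (\<lambda>x z. \<forall>i<k. R (x i) (z i)) =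
      (\<Sum>\<Phi>\<in>A \<rightarrow>\<^sub>E ({..<k} \<rightarrow>\<^sub>E V). \<Prod>i<k. \<Prod>e\<in>F. real (common_degree Z R ((\<lambda>x. x i) ` \<Phi> ` e)))"
    unfolding star_count_def common_degree_power of_nat_prod
    by (intro sum.cong refl prod.swap)
  also have "\<dots> = (\<Sum>g\<in>{..<k} \<rightarrow>\<^sub>E (A \<rightarrow>\<^sub>E V). \<Prod>i<k. ?c (g i))"
  \<comment> \<open>The bijection swaps the two arguments; the restrictions keep both sides
    extensional.\<close>
  proof (rule sum.reindex_bij_witness[
        where j = "\<lambda>\<Phi>. \<lambda>i\<in>{..<k}. \<lambda>v\<in>A. \<Phi> v i" and i = "\<lambda>g. \<lambda>v\<in>A. \<lambda>i\<in>{..<k}. g i v"])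
    fix \<Phi> assume \<Phi>: "\<Phi> \<in> A \<rightarrow>\<^sub>E ({..<k} \<rightarrow>\<^sub>E V)"
    have "(\<lambda>v\<in>A. \<lambda>i\<in>{..<k}. (\<lambda>i\<in>{..<k}. \<lambda>v\<in>A. \<Phi> v i) i v) v i = \<Phi> v i" for v i
      using \<Phi> PiE_arb[OF \<Phi>, of v] PiE_arb[of "\<Phi> v" "{..<k}" "\<lambda>_. V" i] PiE_mem[OF \<Phi>, of v]
      by (cases "v \<in> A"; cases "i < k") auto
    then show "(\<lambda>v\<in>A. \<lambda>i\<in>{..<k}. (\<lambda>i\<in>{..<k}. \<lambda>v\<in>A. \<Phi> v i) i v) = \<Phi>"
      by (intro ext)
    show "(\<lambda>i\<in>{..<k}. \<lambda>v\<in>A. \<Phi> v i) \<in> {..<k} \<rightarrow>\<^sub>E (A \<rightarrow>\<^sub>E V)"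
      using \<Phi> by (fastforce simp: PiE_iff)
    have "(\<lambda>x. x i) ` \<Phi> ` e = (\<lambda>i\<in>{..<k}. \<lambda>v\<in>A. \<Phi> v i) i ` e" if "i < k" "e \<in> F" for i e
    proof -
      have "e \<subseteq> A" using that assms(3) by auto
      then show ?thesis
        unfolding image_image using that by (intro image_cong) auto
    qed
    then show "(\<Prod>i<k. ?c ((\<lambda>i\<in>{..<k}. \<lambda>v\<in>A. \<Phi> v i) i)) =
        (\<Prod>i<k. \<Prod>e\<in>F. real (common_degree Z R ((\<lambda>x. x i) ` \<Phi> ` e)))"
      by (intro prod.cong refl) (simp del: restrict_apply)
  next
    fix g assume g: "g \<in> {..<k} \<rightarrow>\<^sub>E (A \<rightarrow>\<^sub>E V)"
    have "(\<lambda>i\<in>{..<k}. \<lambda>v\<in>A. (\<lambda>v\<in>A. \<lambda>i\<in>{..<k}. g i v) v i) i v = g i v" for v i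
      using g PiE_arb[OF g, of i] PiE_arb[of "g i" A "\<lambda>_. V" v] PiE_mem[OF g, of i]
      by (cases "v \<in> A"; cases "i < k") auto
    then show "(\<lambda>i\<in>{..<k}. \<lambda>v\<in>A. (\<lambda>v\<in>A. \<lambda>i\<in>{..<k}. g i v) v i) = g"
      by (intro ext)
    show "(\<lambda>v\<in>A. \<lambda>i\<in>{..<k}. g i v) \<in> A \<rightarrow>\<^sub>E ({..<k} \<rightarrow>\<^sub>E V)"
      using g by (fastforce simp: PiE_iff)
  qed
  also have "\<dots> = (\<Prod>i<k. star_count A F V Z R)"
    unfolding star_count_def using assms by (subst prod_sum_PiE) (auto intro: finite_PiE)
  finally show ?thesis by simp
qed

text \<open>Together with the cardinalities, this gives the power the density
  \<open>q ^ k\<close>.\<close>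

lemma sum_degrees_power:
  assumes "finite V"
  shows "(\<Sum>x\<in>{..<k} \<rightarrow>\<^sub>E V. real (common_degree ({..<k} \<rightarrow>\<^sub>E Z) (\<lambda>x z. \<forall>i<k. R (x i) (z i)) {x})) =
    (\<Sum>x\<in>V. real (common_degree Z R {x})) ^ k"
proof -
  have "(\<Sum>x\<in>{..<k} \<rightarrow>\<^sub>E V. real (common_degree ({..<k} \<rightarrow>\<^sub>E Z) (\<lambda>x z. \<forall>i<k. R (x i) (z i)) {x})) =
      (\<Prod>i<k. \<Sum>x\<in>V. real (common_degree Z R {x}))"
    unfolding common_degree_power using assms by (subst prod_sum_PiE) auto
  then show ?thesis by simp
qed

text \<open>If \<open>s < t\<close>, then \<open>(s / t) ^ k\<close> eventually drops below
  \<open>c\<close>.\<close>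

lemma le_of_power_le:
  fixes s t c :: real
  assumes "0 < c" "0 \<le> s" "\<And>k. c * t ^ k \<le> s ^ k"
  shows "t \<le> s"
proof (rule ccontr)
  assume "\<not> t \<le> s"
  then have t: "s < t" "0 < t" using assms(2) by auto
  then obtain k where "(s / t) ^ k < c"
    using real_arch_pow_inv[of c "s / t"] assms(1) by auto
  then have "s ^ k < c * t ^ k"
    using t by (simp add: power_divide divide_less_eq)
  with assms(3)[of k] show False by simp
qed

text \<open>The weaker bound is applied to every tensor power: both sides become \<open>k\<close>-th
  powers while the constant stays fixed. The hypothesis on \<open>H\<close> is thereby used at the
  densities \<open>q ^ k / 16\<close>, always with the same \<open>a\<close>.\<close>

lemma star_count_sidorenko:
  assumes H: "simple_graph H" "\<Union>(edges H) = verts H"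
    and f: "f \<in> {0<..1} \<rightarrow> {0<..1}" and "0 < a"
    and bound: "\<And>d. d \<in> {0<..1} \<Longrightarrow> dense_count_bound H f a d"
    and fin: "finite V" "finite Z"
    and q_def: "q = (\<Sum>x\<in>V. real (common_degree Z R {x})) / (real (card V) * real (card Z))"
    and "0 < q"
  shows "real (card V) ^ card (verts H) * real (card Z) ^ card (edges H) * q ^ (2 * card (edges H))
    \<le> star_count (verts H) (edges H) V Z R"
proof (rule le_of_power_le)
  show "0 < a / 2 / 32 ^ card (edges H)" using \<open>0 < a\<close> by simp
  show "0 \<le> star_count (verts H) (edges H) V Z R"
    by (simp add: star_count_def sum_nonneg prod_nonneg)
  fix k :: nat
  let ?V = "{..<k} \<rightarrow>\<^sub>E V" and ?Z = "{..<k} \<rightarrow>\<^sub>E Z" and ?R = "\<lambda>x z. \<forall>i<k. R (x i) (z i)"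
  have cards: "card ?V = card V ^ k" "card ?Z = card Z ^ k"
    by (simp_all add: card_funcsetE)
  have q: "q ^ k = (\<Sum>x\<in>?V. real (common_degree ?Z ?R {x})) / (real (card ?V) * real (card ?Z))"
    unfolding sum_degrees_power[OF fin(1)] cards q_def by (simp add: power_divide power_mult_distrib)
  have "finite (verts H)" using H by (simp add: simple_graph_def)
  then have power: "star_count (verts H) (edges H) ?V ?Z ?R = star_count (verts H) (edges H) V Z R ^ k"
    using fin H by (intro star_count_power) auto
  have "finite ?V" "finite ?Z" using fin by (auto intro: finite_PiE)
  from star_count_ge[OF H f \<open>0 < a\<close> bound this q] \<open>0 < q\<close>
  show "a / 2 / 32 ^ card (edges H) *
      (real (card V) ^ card (verts H) * real (card Z) ^ card (edges H) * q ^ (2 * card (edges H))) ^ k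
      \<le> star_count (verts H) (edges H) V Z R ^ k"
    unfolding cards power by (simp add: power_mult_distrib power_mult[symmetric] mult_ac)
qed

subsection \<open>Isolated vertices\<close>

lemma bij_betw_restrict_pair:
  assumes "A \<inter> B = {}"
  shows "bij_betw (\<lambda>\<phi>. (restrict \<phi> A, restrict \<phi> B)) (A \<union> B \<rightarrow>\<^sub>E V) ((A \<rightarrow>\<^sub>E V) \<times> (B \<rightarrow>\<^sub>E V))"
proof (rule bij_betw_byWitness[where f' = "\<lambda>(f, g) x. if x \<in> A then f x else g x"])
  show "\<forall>\<phi>\<in>A \<union> B \<rightarrow>\<^sub>E V. (\<lambda>(f, g) x. if x \<in> A then f x else g x) (restrict \<phi> A, restrict \<phi> B) = \<phi>"
    by (auto simp: fun_eq_iff PiE_iff extensional_def)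
  show "\<forall>p\<in>(A \<rightarrow>\<^sub>E V) \<times> (B \<rightarrow>\<^sub>E V). (\<lambda>\<phi>. (restrict \<phi> A, restrict \<phi> B))
      ((\<lambda>(f, g) x. if x \<in> A then f x else g x) p) = p"
    using assms by (auto simp: fun_eq_iff PiE_iff extensional_def)
qed (use assms in \<open>auto simp: PiE_iff extensional_def\<close>)

text \<open>Vertices in \<open>B\<close> meet no edge, so their images are free.\<close>

lemma star_count_isolated:
  assumes "finite A" "finite B" "A \<inter> B = {}" "\<Union>F \<subseteq> A"
  shows "star_count (A \<union> B) F V Z R = real (card V) ^ card B * star_count A F V Z R"
proof -
  let ?c = "\<lambda>\<phi>. \<Prod>e\<in>F. real (common_degree Z R (\<phi> ` e))"
  have "star_count (A \<union> B) F V Z R = (\<Sum>\<phi>\<in>A \<union> B \<rightarrow>\<^sub>E V. ?c (fst (restrict \<phi> A, restrict \<phi> B)))"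
    unfolding star_count_def
  proof (intro sum.cong prod.cong refl arg_cong[where f = real] arg_cong[where f = "common_degree Z R"])
    fix \<phi> e assume "e \<in> F"
    then have "e \<subseteq> A" using assms by auto
    then show "\<phi> ` e = fst (restrict \<phi> A, restrict \<phi> B) ` e" by auto
  qed
  also have "\<dots> = (\<Sum>p\<in>(A \<rightarrow>\<^sub>E V) \<times> (B \<rightarrow>\<^sub>E V). ?c (fst p))"
    by (rule sum.reindex_bij_betw[OF bij_betw_restrict_pair[OF assms(3)]])
  also have "\<dots> = (\<Sum>\<phi>\<in>A \<rightarrow>\<^sub>E V. \<Sum>\<psi>\<in>B \<rightarrow>\<^sub>E V. ?c \<phi>)"
    unfolding sum.cartesian_product by (simp add: case_prod_beta)
  also have "\<dots> = real (card V) ^ card B * star_count A F V Z R"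
    using assms by (simp add: star_count_def sum_distrib_left card_funcsetE)
  finally show ?thesis .
qed

definition remove_isolated :: "'a ugraph \<Rightarrow> 'a ugraph" where
  "remove_isolated H = \<lparr>verts = \<Union>(edges H), edges = edges H\<rparr>"

lemma simple_graph_remove_isolated: "simple_graph H \<Longrightarrow> simple_graph (remove_isolated H)"
  by (auto simp: simple_graph_def remove_isolated_def intro: finite_subset)

text \<open>A copy of \<open>H\<close> restricts to a copy of the graph without isolated vertices,
  and each such copy has at most \<open>card (verts G) ^ card ?B\<close> extensions. Dividing by
  this power preserves the bound with the same \<open>f\<close>, \<open>a\<close> and
  \<open>d\<close>.\<close>

lemma dense_count_bound_remove_isolated:
  assumes H: "simple_graph H" and "dense_count_bound H f a d"
  shows "dense_count_bound (remove_isolated H) f a d"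
proof -
  let ?A = "\<Union>(edges H)" and ?B = "verts H - \<Union>(edges H)"
  have AB: "?A \<union> ?B = verts H" "?A \<inter> ?B = {}" and fin: "finite (verts H)"
    using H by (auto simp: simple_graph_def)
  then have fB: "finite ?B" and fA: "finite ?A"
    by (auto intro: finite_subset)
  have card_verts: "card (verts H) = card ?B + card ?A"
    using card_Un_disjoint[OF fA fB AB(2)] AB(1) by simp
  obtain n\<^sub>0 where n\<^sub>0: "\<And>G :: nat ugraph. simple_graph G \<Longrightarrow> n\<^sub>0 \<le> card (verts G) \<Longrightarrow> locally_dense (f d) d G \<Longrightarrow>
      a * real (card (verts G)) ^ card (verts H) * d ^ card (edges H) \<le> real (card (labeled_copies H G))"
    using assms(2) unfolding dense_count_bound_def by blast
  show ?thesis
    unfolding dense_count_bound_def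
  \<comment> \<open>The threshold is at least \<open>1\<close> so that the power of
    \<open>card (verts G)\<close> can be cancelled.\<close>
  proof (intro exI[of _ "max 1 n\<^sub>0"] allI impI)
    fix G :: "nat ugraph"
    assume "simple_graph G \<and> max 1 n\<^sub>0 \<le> card (verts G) \<and> locally_dense (f d) d G"
    then have G: "simple_graph G" "1 \<le> card (verts G)" "n\<^sub>0 \<le> card (verts G)" "locally_dense (f d) d G"
      by auto
    let ?V = "verts G" and ?L = "labeled_copies (remove_isolated H) G"
    have fV: "finite ?V" using G by (simp add: simple_graph_def)
    have fL: "finite ?L"
      by (rule finite_subset[of _ "?A \<rightarrow>\<^sub>E ?V"])
        (auto simp: labeled_copies_def homs_def remove_isolated_def intro!: finite_PiE fA fV)
    let ?j = "\<lambda>\<phi>. (restrict \<phi> ?A, restrict \<phi> ?B)"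
    have bij: "bij_betw ?j (verts H \<rightarrow>\<^sub>E ?V) ((?A \<rightarrow>\<^sub>E ?V) \<times> (?B \<rightarrow>\<^sub>E ?V))"
      using bij_betw_restrict_pair[OF AB(2), of ?V] by (simp only: AB(1))
    have sub: "labeled_copies H G \<subseteq> verts H \<rightarrow>\<^sub>E ?V"
      by (auto simp: labeled_copies_def homs_def)
    have "?j ` labeled_copies H G \<subseteq> ?L \<times> (?B \<rightarrow>\<^sub>E ?V)"
    proof (intro image_subsetI)
      fix \<phi> assume \<phi>: "\<phi> \<in> labeled_copies H G"
      then have mem: "?j \<phi> \<in> (?A \<rightarrow>\<^sub>E ?V) \<times> (?B \<rightarrow>\<^sub>E ?V)"
        using bij_betwE[OF bij] sub by blast
      have "restrict \<phi> ?A ` e \<in> edges G" if "e \<in> edges H" for e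
      proof -
        have "restrict \<phi> ?A ` e = \<phi> ` e" using that by (intro image_cong) auto
        then show ?thesis using \<phi> that by (auto simp: labeled_copies_def homs_def)
      qed
      moreover have "inj_on (restrict \<phi> ?A) ?A"
        using \<phi> AB(1) by (auto simp: labeled_copies_def inj_on_restrict_eq intro: inj_on_subset)
      ultimately show "?j \<phi> \<in> ?L \<times> (?B \<rightarrow>\<^sub>E ?V)"
        using mem by (auto simp: labeled_copies_def homs_def remove_isolated_def)
    qed
    moreover have "inj_on ?j (labeled_copies H G)"
      using bij sub by (auto simp: bij_betw_def intro: inj_on_subset)
    moreover have "finite (?L \<times> (?B \<rightarrow>\<^sub>E ?V))"
      using fL fV fB by (auto intro!: finite_PiE)
    ultimately have "card (labeled_copies H G) \<le> card (?L \<times> (?B \<rightarrow>\<^sub>E ?V))"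
      by (intro card_inj_on_le[of ?j])
    also have "\<dots> = card ?V ^ card ?B * card ?L"
      using fB by (simp only: card_cartesian_product card_funcsetE mult.commute)
    finally have le: "card (labeled_copies H G) \<le> card ?V ^ card ?B * card ?L" .
    have "real (card ?V) ^ card ?B * (a * real (card ?V) ^ card ?A * d ^ card (edges H))
        = a * real (card ?V) ^ card (verts H) * d ^ card (edges H)"
      by (simp add: card_verts power_add)
    also have "\<dots> \<le> real (card (labeled_copies H G))"
      using n\<^sub>0[OF G(1,3,4)] .
    also have "\<dots> \<le> real (card ?V) ^ card ?B * real (card ?L)"
      using of_nat_mono[OF le, where 'a = real] by simp
    finally have "a * real (card ?V) ^ card ?A * d ^ card (edges H) \<le> real (card ?L)"
      using G(2) by simp
    then show "a * real (card (verts G)) ^ card (verts (remove_isolated H)) * d ^ card (edges (remove_isolated H))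
        \<le> real (card (labeled_copies (remove_isolated H) G))"
      by (simp add: remove_isolated_def)
  qed
qed

subsection \<open>Subdivisions\<close>

text \<open>Once the original vertices are placed, the middle vertex of each edge is chosen
  independently among the common neighbours of the images of its ends.\<close>

lemma card_homs_subdivision:
  assumes "simple_graph H" "simple_graph G"
  shows "real (card (homs (subdivision H) G)) =
    star_count (verts H) (edges H) (verts G) (verts G) (\<lambda>x z. {x, z} \<in> edges G)"
proof -
  let ?V = "verts G"
  let ?S = "SIGMA \<phi>:verts H \<rightarrow>\<^sub>E ?V. PiE (edges H) (\<lambda>e. {z \<in> ?V. \<forall>x\<in>\<phi> ` e. {x, z} \<in> edges G})"
  have fin: "finite (verts H)" "finite (edges H)" "finite ?V"
    using assms simple_graph_edges_finite by (auto simp: simple_graph_def)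
  have "bij_betw (\<lambda>(\<phi>, \<psi>). case_sum \<phi> \<psi>) ?S (homs (subdivision H) G)"
  proof (rule bij_betw_byWitness[where f' = "\<lambda>\<Phi>. (\<Phi> \<circ> Inl, \<Phi> \<circ> Inr)"])
    show "\<forall>p\<in>?S. (\<lambda>\<Phi>. (\<Phi> \<circ> Inl, \<Phi> \<circ> Inr)) ((\<lambda>(\<phi>, \<psi>). case_sum \<phi> \<psi>) p) = p"
      by (auto simp: fun_eq_iff)
    show "\<forall>\<Phi>\<in>homs (subdivision H) G. (\<lambda>(\<phi>, \<psi>). case_sum \<phi> \<psi>) (\<Phi> \<circ> Inl, \<Phi> \<circ> Inr) = \<Phi>"
      by (auto simp: fun_eq_iff split: sum.split)
    show "(\<lambda>(\<phi>, \<psi>). case_sum \<phi> \<psi>) ` ?S \<subseteq> homs (subdivision H) G"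
    proof clarsimp
      fix \<phi> \<psi>
      assume \<phi>: "\<phi> \<in> verts H \<rightarrow>\<^sub>E ?V"
        and \<psi>: "\<psi> \<in> PiE (edges H) (\<lambda>e. {z \<in> ?V. \<forall>x\<in>e. {\<phi> x, z} \<in> edges G})"
      have "case_sum \<phi> \<psi> ` {Inl v, Inr e} \<in> edges G" if "e \<in> edges H" "v \<in> e" for v e
        using PiE_mem[OF \<psi> that(1)] that(2) by simp
      moreover have "case_sum \<phi> \<psi> \<in> Inl ` verts H \<union> Inr ` edges H \<rightarrow>\<^sub>E ?V"
        using \<phi> \<psi> by (auto simp: PiE_iff extensional_def image_iff split: sum.split)
      ultimately show "case_sum \<phi> \<psi> \<in> homs (subdivision H) G"
        unfolding homs_def subdivision_def by auto
    qed
    show "(\<lambda>\<Phi>. (\<Phi> \<circ> Inl, \<Phi> \<circ> Inr)) ` homs (subdivision H) G \<subseteq> ?S"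
    proof (intro image_subsetI)
      fix \<Phi> assume \<Phi>: "\<Phi> \<in> homs (subdivision H) G"
      have "{\<Phi> (Inl v), \<Phi> (Inr e)} \<in> edges G" if "e \<in> edges H" "v \<in> e" for v e
      proof -
        have "{Inl v, Inr e} \<in> edges (subdivision H)"
          using that by (auto simp: subdivision_def)
        then have "\<Phi> ` {Inl v, Inr e} \<in> edges G"
          using \<Phi> by (auto simp: homs_def)
        then show ?thesis by simp
      qed
      moreover have dom: "\<Phi> \<in> Inl ` verts H \<union> Inr ` edges H \<rightarrow>\<^sub>E ?V"
        using \<Phi> by (simp add: homs_def subdivision_def)
      \<comment> \<open>Both components must be extensional, so the default value is carried over
        along \<open>Inl\<close> and \<open>Inr\<close>.\<close>
      moreover have "\<Phi> (Inl v) = undefined" if "v \<notin> verts H" for v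
        using that by (intro PiE_arb[OF dom]) auto
      moreover have "\<Phi> (Inr e) = undefined" if "e \<notin> edges H" for e
        using that by (intro PiE_arb[OF dom]) auto
      ultimately show "(\<Phi> \<circ> Inl, \<Phi> \<circ> Inr) \<in> ?S"
        by (simp add: PiE_iff extensional_def)
    qed
  qed
  then have "card (homs (subdivision H) G) = card ?S"
    by (rule bij_betw_same_card[symmetric])
  also have "\<dots> = (\<Sum>\<phi>\<in>verts H \<rightarrow>\<^sub>E ?V. card (PiE (edges H) (\<lambda>e. {z \<in> ?V. \<forall>x\<in>\<phi> ` e. {x, z} \<in> edges G})))"
    using fin by (intro card_SigmaI) (auto intro!: finite_PiE)
  also have "\<dots> = (\<Sum>\<phi>\<in>verts H \<rightarrow>\<^sub>E ?V. \<Prod>e\<in>edges H. common_degree ?V (\<lambda>x z. {x, z} \<in> edges G) (\<phi> ` e))"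
    using fin by (simp add: card_PiE common_degree_def)
  finally show ?thesis by (simp add: star_count_def)
qed

lemma card_verts_subdivision:
  assumes "simple_graph H"
  shows "card (verts (subdivision H)) = card (verts H) + card (edges H)"
proof -
  have "finite (verts H)" "finite (edges H)"
    using assms simple_graph_edges_finite by (auto simp: simple_graph_def)
  then show ?thesis
    by (simp add: subdivision_def card_Plus flip: Plus_def)
qed

lemma card_edges_subdivision:
  assumes "simple_graph H"
  shows "card (edges (subdivision H)) = 2 * card (edges H)"
proof -
  let ?S = "SIGMA e:edges H. e"
  have fin: "finite (edges H)" "\<And>e. e \<in> edges H \<Longrightarrow> finite e"
    using assms simple_graph_edges_finite finite_subset by (auto simp: simple_graph_def)
  have "edges (subdivision H) = (\<lambda>(e, v). {Inl v, Inr e}) ` ?S"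
    by (auto simp: subdivision_def image_iff)
  moreover have "inj_on (\<lambda>(e, v). {Inl v, Inr e}) ?S"
    by (auto simp: inj_on_def doubleton_eq_iff)
  ultimately have "card (edges (subdivision H)) = card ?S"
    by (simp add: card_image)
  also have "\<dots> = (\<Sum>e\<in>edges H. card e)"
    using fin by (simp add: card_SigmaI)
  also have "\<dots> = 2 * card (edges H)"
    using assms by (simp add: simple_graph_def)
  finally show ?thesis .
qed

text \<open>This identifies the incidence density for \<open>V = Z = verts G\<close> with the edge
  density in Sidorenko's inequality.\<close>

lemma sum_degrees_eq_twice_edges:
  assumes G: "simple_graph G"
  shows "(\<Sum>x\<in>verts G. real (common_degree (verts G) (\<lambda>x z. {x, z} \<in> edges G) {x})) =
    2 * real (card (edges G))"
proof -
  let ?V = "verts G" and ?g = "\<lambda>e. if e \<in> edges G then 1 else (0::real)"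
  have fin: "finite ?V" using G by (simp add: simple_graph_def)
  have "real (common_degree ?V (\<lambda>x z. {x, z} \<in> edges G) {x}) = (\<Sum>z\<in>?V - {x}. ?g {x, z})" for x
  proof -
    have "{x, x} \<notin> edges G" using G by (auto simp: simple_graph_def)
    then have "{z \<in> ?V. \<forall>y\<in>{x}. {y, z} \<in> edges G} = (?V - {x}) \<inter> {z. {x, z} \<in> edges G}" by auto
    then show ?thesis
      using fin by (simp add: common_degree_def sum.If_cases)
  qed
  then have "(\<Sum>x\<in>?V. real (common_degree ?V (\<lambda>x z. {x, z} \<in> edges G) {x})) =
      2 * (\<Sum>e\<in>pairs ?V. ?g e)"
    by (simp only: sum_off_diagonal[OF fin, of ?g])
  also have "(\<Sum>e\<in>pairs ?V. ?g e) = real (card (pairs ?V \<inter> edges G))"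
    using fin by (simp add: sum.If_cases finite_pairs Int_def)
  also have "pairs ?V \<inter> edges G = edges G"
    using G by (auto simp: pairs_def simple_graph_def)
  finally show ?thesis .
qed

theorem theorem3p1:
  fixes H :: "'a ugraph"
  assumes "simple_graph H"
    and "\<exists>f \<in> {0<..1} \<rightarrow> {0<..1}. \<exists>a > 0. \<forall>d \<in> {0<..1}. dense_count_bound H f a d"
  shows "sidorenko (subdivision H)"
  unfolding sidorenko_def
proof (intro allI impI)
  fix G :: "nat ugraph"
  assume G: "simple_graph G"
  obtain f a where f: "f \<in> {0<..1} \<rightarrow> {0<..1}" and "0 < a"
    and bound: "\<And>d. d \<in> {0<..1} \<Longrightarrow> dense_count_bound H f a d"
    using assms(2) by blast
  let ?V = "verts G" and ?R = "\<lambda>x z. {x, z} \<in> edges G"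
  let ?A = "\<Union>(edges H)" and ?B = "verts H - \<Union>(edges H)" and ?e = "card (edges H)"
  define q where "q = 2 * real (card (edges G)) / real (card ?V) ^ 2"
  have q: "q = (\<Sum>x\<in>?V. real (common_degree ?V ?R {x})) / (real (card ?V) * real (card ?V))"
    by (simp add: q_def sum_degrees_eq_twice_edges[OF G] power2_eq_square)
  have AB: "?A \<union> ?B = verts H" "?A \<inter> ?B = {}" "finite ?A" "finite ?B"
    using assms(1) by (auto simp: simple_graph_def intro: finite_subset)
  have fV: "finite ?V" using G by (simp add: simple_graph_def)
  have card_verts: "card (verts H) = card ?B + card ?A"
    using card_Un_disjoint[OF AB(3,4,2)] AB(1) by simp
  have homs: "real (card (homs (subdivision H) G)) = real (card ?V) ^ card ?B * star_count ?A (edges H) ?V ?V ?R"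
    using star_count_isolated[OF AB(3,4,2) order_refl, where V = ?V and Z = ?V and R = ?R]
    unfolding AB(1) card_homs_subdivision[OF assms(1) G] .
  have "real (card ?V) ^ card ?A * real (card ?V) ^ ?e * q ^ (2 * ?e) \<le> star_count ?A (edges H) ?V ?V ?R"
  proof -
    have "0 \<le> q" by (simp add: q_def)
    \<comment> \<open>Without edges in \<open>H\<close> both sides equal \<open>1\<close>, even for
      \<open>q = 0\<close>. Otherwise \<open>q = 0\<close> makes the left side vanish; this includes
      the empty \<open>G\<close>, where \<open>q\<close> is \<open>0 / 0 = 0\<close>.\<close>
    then consider "edges H = {}" | "edges H \<noteq> {}" "q = 0" | "0 < q" by fastforce
    then show ?thesis
    proof cases
      case 1
      then show ?thesis by (simp add: star_count_def)
    next
      case 2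
      then have zero: "q ^ (2 * ?e) = 0"
        using simple_graph_edges_finite[OF assms(1)] by (simp add: power_0_left)
      show ?thesis
        unfolding zero by (simp add: star_count_def sum_nonneg prod_nonneg)
    next
      case 3
      from star_count_sidorenko[OF simple_graph_remove_isolated[OF assms(1)] _ f \<open>0 < a\<close>
          dense_count_bound_remove_isolated[OF assms(1) bound] fV fV q this]
      show ?thesis by (simp add: remove_isolated_def)
    qed
  qed
  then have "real (card ?V) ^ card ?B * (real (card ?V) ^ card ?A * real (card ?V) ^ ?e * q ^ (2 * ?e))
      \<le> real (card (homs (subdivision H) G))"
    unfolding homs by (intro mult_left_mono) auto
  then show "real (card ?V) ^ card (verts (subdivision H)) *
      (2 * real (card (edges G)) / real (card ?V) ^ 2) ^ card (edges (subdivision H))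
      \<le> real (card (homs (subdivision H) G))"
    unfolding card_verts_subdivision[OF assms(1)] card_edges_subdivision[OF assms(1)] card_verts q_def
    by (simp add: power_add mult.assoc)
qed

end
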